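(* Consider the bilinear system on $\mathrm{SL}(n)$ $$\dot X(t)=AX(t)+\Big(\sum_{k=1}^{m_1}u_k(t)E_{i_kj_k}+\sum_{k=m_1+1}^{m_2}u_k(t)C_{i_kj_k}\Big)X(t),\qquad X(0)=I_n,$$ with $A\in\mathfrak{sl}(n)$, $E_{i_kj_k}\in\{E_{ij}:1\le i\ne j\le n\}$ for $k=1,\dots,m_1$, and $C_{i_kj_k}\in\{C_{ij}:1\le i\ne j\le n\}$ for $k=m_1+1,\dots,m_2$. Suppose the weakly connected components of $\mathcal{G}_{\rm contr}$ satisfy: (i) they are all strongly connected with at least two nodes; (ii) one of them contains at least three nodes. Then the system is accessible on $\mathrm{SL}(n)$ if and only if the union digraph $\mathcal{G}_{\rm drift}\cup\mathcal{G}_{\rm contr}:=(\mathrm{V},\mathcal{E}_{\rm drift}\cup\mathcal{E}_{\rm contr})$ is strongly connected.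
   Context: $\mathrm{SL}(n)$ is the group of real $n\times n$ matrices of determinant one, and $\mathfrak{sl}(n)$ is its Lie algebra of real traceless $n\times n$ matrices. $E_{ij}\in\mathbb{R}^{n\times n}$ has $(i,j)$-entry $1$ and all other entries $0$, and $C_{ij}=E_{ii}-E_{jj}$. The controls $u_k(t)\in\mathbb{R}$, $k=1,\dots,m_2$, are piecewise constant functions. For $T\ge 0$, $\mathcal{R}_T(I_n)$ is the set of all terminal points $X(T)$ of solutions of the system with $X(0)=I_n$ (over all admissible controls), and $\mathcal{R}(I_n)=\bigcup_{T\ge 0}\mathcal{R}_T(I_n)$. The system is accessible on $\mathrm{SL}(n)$ if $\mathcal{R}(I_n)$ has an interior point in $\mathrm{SL}(n)$. Let $\mathrm{V}=\{1,\dots,n\}$. The drift interaction graph is the digraph $\mathcal{G}_{\rm drift}=(\mathrm{V},\mathcal{E}_{\rm drift})$ where, for $i\ne j$ in $\mathrm{V}$, $(i,j)\in\mathcal{E}_{\rm drift}$ if and only if $[A]_{ij}\ne 0$ (no self-loops). The controlled interaction graph is the digraph $\mathcal{G}_{\rm contr}=(\mathrm{V},\mathcal{E}_{\rm contr})$ with arc set $\mathcal{E}_{\rm contr}=\{(i_1,j_1),\dots,(i_{m_1},j_{m_1})\}$ (the terms $C_{i_kj_k}$ do not contribute arcs). A digraph is strongly connected if every two nodes are mutually reachable by directed paths; a node is reachable from itself. A weakly connected component of a digraph is a connected component when arc directions are ignored (an isolated node is a component with one node). *)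

theory Defs
  imports "HOL-Analysis.Analysis" "Graph_Theory.Digraph_Component"
begin

definition SL :: "(real^'n^'n) set" where
  "SL = {X. det X = 1}"

definition sl :: "(real^'n^'n) set" where
  "sl = {A. trace A = 0}"

definition E_mat :: "'n \<Rightarrow> 'n \<Rightarrow> real^'n^'n" where
  "E_mat i j = (\<chi> a b. if a = i \<and> b = j then 1 else 0)"

definition C_mat :: "'n \<Rightarrow> 'n \<Rightarrow> real^'n^'n" where
  "C_mat i j = E_mat i i - E_mat j j"

text \<open>Values at the finitely many breakpoints are arbitrary.\<close>

definition piecewise_constant_on :: "real set \<Rightarrow> (real \<Rightarrow> real) \<Rightarrow> bool" where
  "piecewise_constant_on D f \<longleftrightarrow>
     (\<exists>S. finite S \<and> (\<forall>I. is_interval I \<and> I \<subseteq> D - S \<longrightarrow> f constant_on I))"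

definition control_matrix ::
  "nat \<Rightarrow> nat \<Rightarrow> (nat \<Rightarrow> 'n) \<Rightarrow> (nat \<Rightarrow> 'n) \<Rightarrow> (nat \<Rightarrow> real) \<Rightarrow> real^'n^'n" where
  "control_matrix m1 m2 i j w =
     (\<Sum>k = 1..m1. w k *\<^sub>R E_mat (i k) (j k)) + (\<Sum>k = m1+1..m2. w k *\<^sub>R C_mat (i k) (j k))"

text \<open>A piecewise constant control may jump, so a solution is a continuous curve in \<^term>\<open>SL\<close>
  satisfying the differential equation except at finitely many times.\<close>

definition is_solution ::
  "real^'n^'n \<Rightarrow> nat \<Rightarrow> nat \<Rightarrow> (nat \<Rightarrow> 'n) \<Rightarrow> (nat \<Rightarrow> 'n) \<Rightarrow> (nat \<Rightarrow> real \<Rightarrow> real) \<Rightarrow> real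
     \<Rightarrow> (real \<Rightarrow> real^'n^'n) \<Rightarrow> bool" where
  "is_solution A m1 m2 i j u T X \<longleftrightarrow>
     continuous_on {0..T} X \<and> X ` {0..T} \<subseteq> SL \<and>
     (\<exists>S. finite S \<and> (\<forall>t \<in> {0..T} - S.
        (X has_vector_derivative
           (A ** X t + control_matrix m1 m2 i j (\<lambda>k. u k t) ** X t)) (at t within {0..T})))"

definition reachable_at ::
  "real^'n^'n \<Rightarrow> nat \<Rightarrow> nat \<Rightarrow> (nat \<Rightarrow> 'n) \<Rightarrow> (nat \<Rightarrow> 'n) \<Rightarrow> real \<Rightarrow> (real^'n^'n) set" where
  "reachable_at A m1 m2 i j T =
     {X T | X u. (\<forall>k \<in> {1..m2}. piecewise_constant_on {0..T} (u k)) \<and>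
                 is_solution A m1 m2 i j u T X \<and> X 0 = mat 1}"

definition reachable_set ::
  "real^'n^'n \<Rightarrow> nat \<Rightarrow> nat \<Rightarrow> (nat \<Rightarrow> 'n) \<Rightarrow> (nat \<Rightarrow> 'n) \<Rightarrow> (real^'n^'n) set" where
  "reachable_set A m1 m2 i j = (\<Union>T \<in> {0..}. reachable_at A m1 m2 i j T)"

definition accessible ::
  "real^'n^'n \<Rightarrow> nat \<Rightarrow> nat \<Rightarrow> (nat \<Rightarrow> 'n) \<Rightarrow> (nat \<Rightarrow> 'n) \<Rightarrow> bool" where
  "accessible A m1 m2 i j \<longleftrightarrow> (top_of_set SL) interior_of (reachable_set A m1 m2 i j) \<noteq> {}"

definition drift_graph :: "real^'n^'n \<Rightarrow> ('n, 'n \<times> 'n) pre_digraph" where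
  "drift_graph A = with_proj \<lparr> pverts = UNIV, parcs = {(a, b). a \<noteq> b \<and> A $ a $ b \<noteq> 0} \<rparr>"

definition contr_graph :: "nat \<Rightarrow> (nat \<Rightarrow> 'n) \<Rightarrow> (nat \<Rightarrow> 'n) \<Rightarrow> ('n, 'n \<times> 'n) pre_digraph" where
  "contr_graph m1 i j = with_proj \<lparr> pverts = UNIV, parcs = (\<lambda>k. (i k, j k)) ` {1..m1} \<rparr>"

text \<open>\<^const>\<open>Digraph_Component.connected\<close> is connectedness of the underlying undirected graph, and
  a maximal subgraph with this property contains every arc joining two of its nodes.\<close>

definition weak_components :: "('a, 'b) pre_digraph \<Rightarrow> ('a, 'b) pre_digraph set" where
  "weak_components G = {H. pre_digraph.max_subgraph G Digraph_Component.connected H}"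

end

theory Submission
  imports Defs
begin

text \<open>
  If the union digraph is not strongly connected, the set of nodes reachable from a suitable
  node \<open>x\<close> misses some node \<open>y\<close>, and no arc leaves this set. Every admissible right-hand side
  then has a zero block, so the entries of \<open>X(t)\<close> in the rows of that set and in column \<open>y\<close>
  solve a homogeneous linear equation of their own. They start at zero and stay zero
  (\<open>reachable_block_zero\<close>, a Gronwall estimate), and a subset of \<^const>\<open>SL\<close> on which a fixed
  entry vanishes has empty interior (\<open>not_accessible_if_zero_entry\<close>).

  For the converse, accessibility is reduced to a question about Lie algebras in the spirit of
  Krener's theorem, but by linear algebra and one open mapping theorem in place of flows on
  manifolds. Products \<open>exp (t\<^sub>k B\<^sub>k) \<cdots> exp (t\<^sub>1 B\<^sub>1)\<close> of
  exponentials of admissible matrices with positive times are reachable. Varying the times moves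
  such a point \<open>g\<close> in the directions \<open>v g\<close> with \<open>v\<close> in a subspace \<open>W\<close>, and one more factor
  \<open>exp (t B)\<close> replaces \<open>W\<close> by the conjugate under \<open>exp (t B)\<close> of \<open>W + \<real> B\<close>
  (\<open>attained_extend\<close>). If \<open>W\<close> has maximal dimension, it contains every admissible matrix \<open>B\<close>,
  and its conjugates are maximal as well. So \<open>W\<close> contains all the backward conjugates of
  admissible matrices; differentiating the conjugations shows that their span contains a Lie
  algebra that contains all admissible matrices (\<open>maximal_contains_lie_subalgebra\<close>). When that
  Lie algebra is all of \<^const>\<open>sl\<close>, the product map is a submersion to \<^const>\<open>SL\<close> at a
  suitable point, and its image has an interior point there (\<open>interior_of_if_attained_sl\<close>).

  It remains to see that a Lie subalgebra \<open>L\<close> that contains \<open>A\<close> and the control matrices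
  \<open>E_mat a b\<close> contains \<^const>\<open>sl\<close> (\<open>generates_sl\<close>). For distinct \<open>a\<close>, \<open>b\<close>, \<open>c\<close> the commutator
  of \<open>E_mat a b\<close> and \<open>E_mat b c\<close> is \<open>E_mat a c\<close>; hence \<open>L\<close> contains \<open>E_mat a b\<close> for all distinct
  \<open>a\<close>, \<open>b\<close> in the same strongly connected component of the controlled graph. The only difficulty
  is a nonzero drift entry \<open>A $ q $ r\<close> between two components, since \<open>A\<close> may have many other
  nonzero entries. Three commutators isolate it (\<open>triple_comm_extracts_E_mat\<close>), at the price of
  two auxiliary nodes from which \<open>q\<close> has already been reached, and one further node in the
  component of \<open>r\<close>. A component with three nodes supplies the former when paths are started
  there, even if \<open>q\<close> is one of the three, and the assumption that every component has at least
  two nodes supplies the latter. Strong connectivity of the union graph then links this large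
  component to every node in both directions.
\<close>

section \<open>Weak components and strong connectivity\<close>

lemma singleton_connected:
  fixes G :: "('a, 'b) pre_digraph"
  shows "Digraph_Component.connected (G\<lparr>verts := {r}, arcs := {}\<rparr>)"
  unfolding Digraph_Component.connected_def strongly_connected_def reachable_def mk_symmetric_def
  by auto

text \<open>The component is a largest connected subgraph that contains the given node; the search starts from
  the subgraph that consists of this node alone.\<close>

lemma node_in_weak_component:
  fixes G :: "('a, 'b) pre_digraph"
  assumes "fin_digraph G" and r: "r \<in> verts G"
  obtains H where "H \<in> weak_components G" and "r \<in> verts H"
proof -
  interpret fin_digraph G by fact
  let ?P = "\<lambda>H. subgraph H G \<and> Digraph_Component.connected H \<and> r \<in> verts H"
  let ?size = "\<lambda>H :: ('a, 'b) pre_digraph. card (verts H) + card (arcs H)"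
  have start: "?P (G\<lparr>verts := {r}, arcs := {}\<rparr>)"
    using r singleton_connected[where G = G and r = r]
    by (simp add: subgraph_def compatible_def wf_digraph_def wf_digraph)
  have bound: "\<forall>H. ?P H \<longrightarrow> ?size H < Suc (card (verts G) + card (arcs G))"
    by (auto simp: subgraph_def less_Suc_eq_le intro!: add_mono card_mono)
  obtain H where greatest: "?P H \<and> (\<forall>H'. ?P H' \<longrightarrow> ?size H' \<le> ?size H)"
    using ex_has_greatest_nat[where P = ?P and f = ?size, OF start bound] by (rule exE)
  then have H: "?P H" and max: "\<And>H'. ?P H' \<Longrightarrow> ?size H' \<le> ?size H"
    by auto
  have "max_subgraph Digraph_Component.connected H"
  proof (rule max_subgraphI)
    fix H' assume ne: "H \<noteq> H'" and sub: "subgraph H H'" "subgraph H' G"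
    show "\<not> Digraph_Component.connected H'"
    proof
      assume "Digraph_Component.connected H'"
      with sub H have size: "?size H' \<le> ?size H" by (intro max) (auto simp: subgraph_def)
      have fin: "finite (verts H')" "finite (arcs H')"
        using sub(2) by (auto simp: subgraph_def intro: finite_subset)
      have incl: "verts H \<subseteq> verts H'" "arcs H \<subseteq> arcs H'"
        using sub(1) by (auto simp: subgraph_def)
      have "card (verts H) \<le> card (verts H')" "card (arcs H) \<le> card (arcs H')"
        by (rule card_mono[OF fin(1) incl(1)], rule card_mono[OF fin(2) incl(2)])
      with size have card_eq: "card (verts H) = card (verts H')" "card (arcs H) = card (arcs H')"
        by linarith+
      have "verts H = verts H'" "arcs H = arcs H'"
        using card_subset_eq[OF fin(1) incl(1) card_eq(1)] card_subset_eq[OF fin(2) incl(2) card_eq(2)]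
        by simp_all
      with ne sub(1) show False by (auto simp: subgraph_def compatible_def)
    qed
  qed (use H in auto)
  with H that show thesis by (auto simp: weak_components_def)
qed

lemma strongly_connected_iff_rtrancl:
  assumes "wf_digraph G" and "verts G = UNIV"
  shows "strongly_connected G \<longleftrightarrow> (\<forall>u v. (u, v) \<in> (arcs_ends G)\<^sup>*)"
  using assms unfolding strongly_connected_def by (auto simp: wf_digraph.reachable_conv)

lemma strongly_connected_union_iff:
  "strongly_connected (Digraph_Component.union (drift_graph A) (contr_graph m1 i j)) \<longleftrightarrow>
     (\<forall>u v. (u, v) \<in> ({(a, b). a \<noteq> b \<and> A $ a $ b \<noteq> 0} \<union> (\<lambda>k. (i k, j k)) ` {1..m1})\<^sup>*)"
proof -
  let ?G = "Digraph_Component.union (drift_graph A) (contr_graph m1 i j)"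
  have "arcs_ends ?G = {(a, b). a \<noteq> b \<and> A $ a $ b \<noteq> 0} \<union> (\<lambda>k. (i k, j k)) ` {1..m1}"
    by (simp add: arcs_ends_def arc_to_ends_def Digraph_Component.union_def drift_graph_def
        contr_graph_def)
  moreover have "wf_digraph ?G" "verts ?G = UNIV"
    by (auto simp: wf_digraph_def Digraph_Component.union_def drift_graph_def contr_graph_def)
  ultimately show ?thesis
    by (simp add: strongly_connected_iff_rtrancl)
qed

text \<open>Hypotheses about weak components enter the rest of the proof only through reachability along
  control arcs, which this lemma and the next one provide.\<close>

lemma weak_component_reach:
  assumes "H \<in> weak_components (contr_graph m1 i j)" and "strongly_connected H"
    and "u \<in> verts H" and "v \<in> verts H"
  shows "(u, v) \<in> ((\<lambda>k. (i k, j k)) ` {1..m1})\<^sup>*"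
proof -
  have "subgraph H (contr_graph m1 i j)"
    using assms(1) by (auto simp: weak_components_def pre_digraph.max_subgraph_def)
  then have "arcs_ends H \<subseteq> (\<lambda>k. (i k, j k)) ` {1..m1}"
    by (auto simp: subgraph_def compatible_def contr_graph_def arcs_ends_def arc_to_ends_def)
  moreover have "(u, v) \<in> (arcs_ends H)\<^sup>*"
    using assms by (auto simp: strongly_connected_def intro: reachable_rtranclI)
  ultimately show ?thesis
    using rtrancl_mono by blast
qed

lemma control_graph_nodes:
  fixes i j :: "nat \<Rightarrow> 'n::finite"
  assumes "\<forall>H \<in> weak_components (contr_graph m1 i j). strongly_connected H \<and> card (verts H) \<ge> 2"
    and "\<exists>H \<in> weak_components (contr_graph m1 i j). card (verts H) \<ge> 3"
  defines "R \<equiv> ((\<lambda>k. (i k, j k)) ` {1..m1})\<^sup>*"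
  shows "\<exists>s. s \<noteq> r \<and> (r, s) \<in> R \<and> (s, r) \<in> R"
    and "\<exists>P. card P = 3 \<and> P \<times> P \<subseteq> R"
proof -
  have "fin_digraph (contr_graph m1 i j)"
    by unfold_locales (auto simp: contr_graph_def)
  then obtain H where H: "H \<in> weak_components (contr_graph m1 i j)" "r \<in> verts H"
    by (rule node_in_weak_component[where r = r]) (auto simp: contr_graph_def)
  with assms(1) have sc: "strongly_connected H" and "card (verts H) \<ge> 2" by auto
  then have "\<not> verts H \<subseteq> {r}"
    using card_mono[of "{r}" "verts H"] by auto
  then obtain s where "s \<in> verts H" "s \<noteq> r" by auto
  with H sc show "\<exists>s. s \<noteq> r \<and> (r, s) \<in> R \<and> (s, r) \<in> R"
    unfolding R_def using weak_component_reach[OF H(1) sc] by (intro exI[of _ s]) simp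
next
  obtain H where H: "H \<in> weak_components (contr_graph m1 i j)" "card (verts H) \<ge> 3"
    using assms(2) by auto
  then obtain P where "P \<subseteq> verts H" "card P = 3" by (metis obtain_subset_with_card_n)
  with H assms(1) show "\<exists>P. card P = 3 \<and> P \<times> P \<subseteq> R"
    unfolding R_def using weak_component_reach[OF H(1)] by (intro exI[of _ P]) blast
qed

section \<open>Lie algebras of matrices generated by elementary matrices\<close>

definition comm :: "real^'n^'n \<Rightarrow> real^'n^'n \<Rightarrow> real^'n^'n" where
  "comm X Y = X ** Y - Y ** X"

definition lie_subalgebra :: "(real^'n^'n) set \<Rightarrow> bool" where
  "lie_subalgebra L \<longleftrightarrow> subspace L \<and> (\<forall>X\<in>L. \<forall>Y\<in>L. comm X Y \<in> L)"

lemma E_mat_nth: "E_mat a b $ c $ d = (if c = a \<and> d = b then 1 else 0)"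
  by (simp add: E_mat_def)

lemma matrix_mult_nth: "(X ** Y) $ x $ y = (\<Sum>k\<in>UNIV. X $ x $ k * Y $ k $ y)"
  by (simp add: matrix_matrix_mult_def)

lemma E_mat_mult_left: "(E_mat a b ** M) $ x $ y = (if x = a then M $ b $ y else 0)"
proof -
  have "(E_mat a b ** M) $ x $ y = (\<Sum>k\<in>UNIV. if k = b then (if x = a then M $ b $ y else 0) else 0)"
    unfolding matrix_mult_nth by (intro sum.cong) (auto simp: E_mat_nth)
  then show ?thesis by simp
qed

lemma E_mat_mult_right: "(M ** E_mat a b) $ x $ y = (if y = b then M $ x $ a else 0)"
proof -
  have "(M ** E_mat a b) $ x $ y = (\<Sum>k\<in>UNIV. if k = a then (if y = b then M $ x $ a else 0) else 0)"
    unfolding matrix_mult_nth by (intro sum.cong) (auto simp: E_mat_nth)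
  then show ?thesis by simp
qed

lemma E_mat_mult: "E_mat a b ** E_mat c d = (if b = c then E_mat a d else 0)"
  by (auto simp: vec_eq_iff E_mat_mult_left E_mat_nth)

lemma transpose_E_mat: "transpose (E_mat a b) = E_mat b a"
  by (auto simp: transpose_def E_mat_def vec_eq_iff)

lemma transpose_comm:
  fixes X Y :: "real^'a^'a"
  shows "transpose (comm X Y) = comm (transpose Y) (transpose X)"
proof -
  have "transpose (U - V) = transpose U - transpose V" for U V :: "real^'a^'a"
    by (simp add: transpose_def vec_eq_iff)
  then show ?thesis by (simp add: comm_def matrix_transpose_mul)
qed

lemma lie_subalgebra_transpose:
  fixes L :: "(real^'n^'n) set"
  assumes "lie_subalgebra L"
  shows "lie_subalgebra (transpose ` L)"
proof -
  have "linear (transpose :: real^'n^'n \<Rightarrow> real^'n^'n)"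
    by (rule linearI) (simp_all add: transpose_def vec_eq_iff)
  then have "subspace (transpose ` L)"
    using assms by (simp add: lie_subalgebra_def linear_subspace_image)
  moreover have "comm (transpose X) (transpose Y) \<in> transpose ` L" if "X \<in> L" "Y \<in> L" for X Y
    using assms that by (auto simp: lie_subalgebra_def transpose_comm[symmetric])
  ultimately show ?thesis by (auto simp: lie_subalgebra_def)
qed

text \<open>A reflexive version of membership, which makes the relation a preorder on the nodes: the diagonal
  matrices \<open>E_mat a a\<close> are not traceless and cannot be expected to lie in \<open>L\<close>.\<close>

definition joined :: "(real^'n^'n) set \<Rightarrow> 'n \<Rightarrow> 'n \<Rightarrow> bool" where
  "joined L a b \<longleftrightarrow> a = b \<or> E_mat a b \<in> L"

lemma joined_trans:
  assumes L: "lie_subalgebra L" and ab: "joined L a b" and bc: "joined L b c"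
  shows "joined L a c"
proof (cases "a = b \<or> b = c \<or> a = c")
  case False
  with ab bc have "comm (E_mat a b) (E_mat b c) \<in> L"
    using L by (auto simp: joined_def lie_subalgebra_def)
  also have "comm (E_mat a b) (E_mat b c) = E_mat a c"
    using False by (auto simp: comm_def E_mat_mult)
  finally show ?thesis by (simp add: joined_def)
qed (use ab bc in \<open>auto simp: joined_def\<close>)

lemma joined_transpose: "joined (transpose ` L) a b \<longleftrightarrow> joined L b a"
  unfolding joined_def by (metis image_iff transpose_E_mat transpose_transpose)

lemma joined_rtrancl:
  assumes L: "lie_subalgebra L" and E: "\<And>a b. (a, b) \<in> R \<Longrightarrow> joined L a b"
    and "(u, v) \<in> R\<^sup>*"
  shows "joined L u v"
  using assms(3)
proof (induction rule: rtrancl_induct)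
  case base
  then show ?case by (simp add: joined_def)
next
  case (step y z)
  then show ?case using joined_trans[OF L] E by blast
qed

text \<open>The first commutator leaves only row \<open>p1\<close>, which receives row \<open>q\<close> of \<open>A\<close>, and column \<open>q\<close>.
  The second one keeps from these only the entry at \<open>r\<close>, moved to column \<open>r'\<close>, together with one
  multiple of \<open>E_mat r q\<close>. Left multiplication by \<open>E_mat p2 p1\<close> picks out row \<open>p1\<close> and
  annihilates this remainder; the products in the opposite order vanish because the five nodes
  are distinct.\<close>

lemma triple_comm_extracts_E_mat:
  assumes "distinct [p1, p2, q, r, r']"
  shows "comm (E_mat p2 p1) (comm (comm (E_mat p1 q) A) (E_mat r r')) = A $ q $ r *\<^sub>R E_mat p2 r'"
proof -
  have neq: "p1 \<noteq> p2" "p1 \<noteq> q" "p1 \<noteq> r" "p1 \<noteq> r'" "p2 \<noteq> p1" "p2 \<noteq> q" "p2 \<noteq> r" "p2 \<noteq> r'" "q \<noteq> p1" "q \<noteq> p2"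
    "q \<noteq> r" "q \<noteq> r'" "r \<noteq> p1" "r \<noteq> p2" "r \<noteq> q" "r \<noteq> r'" "r' \<noteq> p1" "r' \<noteq> p2" "r' \<noteq> q" "r' \<noteq> r"
    using assms by auto
  define M where "M = comm (comm (E_mat p1 q) A) (E_mat r r')"
  have M: "M $ x $ y = (if x = p1 \<and> y = r' then A $ q $ r else 0)
                     + (if x = r \<and> y = q then A $ r' $ p1 else 0)" for x y
    unfolding M_def by (simp add: comm_def E_mat_mult_left E_mat_mult_right neq)
  have "comm (E_mat p2 p1) M = A $ q $ r *\<^sub>R E_mat p2 r'"
    by (simp add: vec_eq_iff comm_def E_mat_mult_left E_mat_mult_right M E_mat_nth neq)
  then show ?thesis by (simp add: M_def)
qed

text \<open>A drift arc \<open>(q, r)\<close> can be traversed. Otherwise \<open>r\<close> and its partner \<open>r'\<close> would lie outside the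
  set of nodes that the three mutually joined nodes of \<open>P\<close> reach, while \<open>q\<close> and all of \<open>P\<close> lie inside.
  At least two nodes of \<open>P\<close> differ from \<open>q\<close>, so the preceding lemma applies to five distinct
  nodes and joins a node of \<open>P\<close> to \<open>r'\<close>. The node \<open>q\<close> may itself belong to \<open>P\<close>: this is why three
  nodes are asked for.\<close>

lemma joined_drift_arc:
  assumes L: "lie_subalgebra L" and A: "A \<in> L"
    and P: "card P = 3" "\<And>p p'. p \<in> P \<Longrightarrow> p' \<in> P \<Longrightarrow> joined L p p'" "p \<in> P"
    and r': "r' \<noteq> r" "joined L r r'" "joined L r' r"
    and q: "joined L p q" and arc: "A $ q $ r \<noteq> 0"
  shows "joined L p r"
proof (rule ccontr)
  assume "\<not> joined L p r"
  with P have r: "\<not> joined L p' r" if "p' \<in> P" for p'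
    using that joined_trans[OF L] by blast
  obtain p1 p2 where p: "p1 \<in> P" "p2 \<in> P" "p1 \<noteq> p2" "p1 \<noteq> q" "p2 \<noteq> q"
  proof -
    have "finite P" using P(1) card.infinite by fastforce
    then have "card (P - {q}) \<ge> 2" using P(1) by (cases "q \<in> P") auto
    then obtain Q where "Q \<subseteq> P - {q}" "card Q = 2" by (metis obtain_subset_with_card_n)
    then show thesis using that by (auto simp: card_2_iff)
  qed
  have "joined L p' q" if "p' \<in> P" for p'
    using joined_trans[OF L] P q that by blast
  moreover have "joined L q q" by (simp add: joined_def)
  moreover have "\<not> joined L q r"
    using joined_trans[OF L q] \<open>\<not> joined L p r\<close> by blast
  ultimately have d: "distinct [p1, p2, q, r, r']"
    using p r r' joined_trans[OF L] by (auto simp: joined_def)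
  have "E_mat p2 p1 \<in> L" "E_mat p1 q \<in> L" "E_mat r r' \<in> L"
    using d P(2)[OF p(2,1)] \<open>\<And>p'. p' \<in> P \<Longrightarrow> joined L p' q\<close>[OF p(1)] r'(2) by (auto simp: joined_def)
  then have "comm (E_mat p2 p1) (comm (comm (E_mat p1 q) A) (E_mat r r')) \<in> L"
    using L A by (simp add: lie_subalgebra_def)
  then have "(1 / A $ q $ r) *\<^sub>R (A $ q $ r *\<^sub>R E_mat p2 r') \<in> L"
    using L unfolding triple_comm_extracts_E_mat[OF d]
    by (simp only: lie_subalgebra_def subspace_scale)
  then have "joined L p2 r'" using arc by (simp add: joined_def)
  then show False using joined_trans[OF L] r'(3) r p(2) by blast
qed

lemma matrix_sum_E_mat:
  fixes M :: "real^'n^'n"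
  shows "M = (\<Sum>a\<in>UNIV. \<Sum>b\<in>UNIV. M $ a $ b *\<^sub>R E_mat a b)"
proof -
  have "(\<Sum>a\<in>UNIV. \<Sum>b\<in>UNIV. M $ a $ b *\<^sub>R E_mat a b) $ x $ y = M $ x $ y" for x y
  proof -
    have "(\<Sum>a\<in>UNIV. \<Sum>b\<in>UNIV. M $ a $ b *\<^sub>R E_mat a b) $ x $ y =
        (\<Sum>a\<in>UNIV. \<Sum>b\<in>UNIV. M $ a $ b * E_mat a b $ x $ y)"
      by simp
    also have "\<dots> = (\<Sum>a\<in>UNIV. \<Sum>b\<in>UNIV. if b = y then (if a = x then M $ x $ y else 0) else 0)"
      by (intro sum.cong refl) (auto simp: E_mat_nth)
    finally show ?thesis by simp
  qed
  then show ?thesis by (simp add: vec_eq_iff)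
qed

text \<open>The diagonal part of a traceless matrix is a combination of differences \<open>E_mat a a - E_mat z z\<close>,
  which are the commutators of \<open>E_mat a z\<close> and \<open>E_mat z a\<close>.\<close>

lemma sl_subset_lie_subalgebra:
  fixes L :: "(real^'n^'n) set"
  assumes L: "lie_subalgebra L" and E: "\<And>a b. joined L a b"
  shows "sl \<subseteq> L"
proof
  fix M :: "real^'n^'n" assume "M \<in> sl"
  then have tr: "(\<Sum>a\<in>UNIV. M $ a $ a) = 0" by (simp add: sl_def trace_def)
  \<comment> \<open>An arbitrary reference node.\<close>
  define z :: 'n where "z = undefined"
  have L': "subspace L" using L by (simp add: lie_subalgebra_def)
  have diag: "E_mat a a - E_mat z z \<in> L" for a
  proof (cases "a = z")
    case False
    then have "comm (E_mat a z) (E_mat z a) \<in> L"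
      using L E[of a z] E[of z a] by (auto simp: lie_subalgebra_def joined_def)
    then show ?thesis by (simp add: comm_def E_mat_mult)
  qed (use L' in \<open>simp add: subspace_0\<close>)
  have "M = (\<Sum>a\<in>UNIV. \<Sum>b\<in>UNIV. M $ a $ b *\<^sub>R E_mat a b) - (\<Sum>a\<in>UNIV. M $ a $ a) *\<^sub>R E_mat z z"
    using matrix_sum_E_mat[of M] tr by simp
  also have "\<dots> = (\<Sum>a\<in>UNIV. \<Sum>b\<in>UNIV. M $ a $ b *\<^sub>R (E_mat a b - (if a = b then E_mat z z else 0)))"
  proof -
    have "(\<Sum>b\<in>UNIV. M $ a $ b *\<^sub>R (if a = b then E_mat z z else 0)) = M $ a $ a *\<^sub>R E_mat z z" for a
      by (simp add: if_distrib cong: if_cong)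
    then show ?thesis by (simp add: scaleR_diff_right sum_subtractf scaleR_left.sum)
  qed
  also have "\<dots> \<in> L"
    using diag E L' by (intro subspace_sum subspace_scale) (auto simp: joined_def)
  finally show "M \<in> L" .
qed

text \<open>Paths of the union graph that start in \<open>P\<close> are followed with \<open>joined_drift_arc\<close>. Paths that end in
  \<open>P\<close> are treated by the same lemma, applied to the transposed Lie algebra and to the transpose
  of \<open>A\<close>, which reverses all arcs.\<close>

lemma generates_sl:
  fixes A :: "real^'n^'n" and R :: "('n \<times> 'n) set"
  assumes L: "lie_subalgebra L" and A: "A \<in> L"
    and E: "\<And>a b. (a, b) \<in> R \<Longrightarrow> E_mat a b \<in> L"
    and two: "\<And>r. \<exists>s. s \<noteq> r \<and> (r, s) \<in> R\<^sup>* \<and> (s, r) \<in> R\<^sup>*"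
    and three: "card P = 3" "P \<times> P \<subseteq> R\<^sup>*"
    and sc: "\<And>u v. (u, v) \<in> ({(a, b). a \<noteq> b \<and> A $ a $ b \<noteq> 0} \<union> R)\<^sup>*"
  shows "sl \<subseteq> L"
proof (rule sl_subset_lie_subalgebra[OF L])
  have R: "joined L u v" if "(u, v) \<in> R\<^sup>*" for u v
    using joined_rtrancl[OF L _ that] E by (auto simp: joined_def)
  have P: "joined L p p'" if "p \<in> P" "p' \<in> P" for p p'
    using that three(2) R by blast
  obtain p where p: "p \<in> P" using three(1) by (cases "P = {}") auto
  note L\<^sub>T = lie_subalgebra_transpose[OF L]
  have out: "joined L p v" for v
    using sc[of p v]
  proof (induction rule: rtrancl_induct)
    case (step q r)
    obtain r' where r': "r' \<noteq> r" "joined L r r'" "joined L r' r" using two[of r] R by auto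
    show ?case
    proof (cases "A $ q $ r = 0")
      case True
      with step E have "joined L q r" by (auto simp: joined_def)
      then show ?thesis using joined_trans[OF L step.IH] by blast
    next
      case False
      then show ?thesis using joined_drift_arc[OF L A three(1) P p r' step.IH] by simp
    qed
  qed (simp add: joined_def)
  have into: "joined L v p" for v
    using sc[of v p]
  proof (induction rule: converse_rtrancl_induct)
    case (step r q)
    obtain r' where r': "r' \<noteq> r" "joined L r r'" "joined L r' r" using two[of r] R by auto
    show ?case
    proof (cases "A $ r $ q = 0")
      case True
      with step E have "joined L r q" by (auto simp: joined_def)
      then show ?thesis using joined_trans[OF L _ step.IH] by blast
    next
      case False
      then have arc: "transpose A $ q $ r \<noteq> 0" by (simp add: transpose_def)
      show ?thesis
        using joined_drift_arc[OF L\<^sub>T imageI[OF A] three(1) _ p r'(1) _ _ _ arc] P r' step.IH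
        by (simp add: joined_transpose)
    qed
  qed (simp add: joined_def)
  show "joined L a b" for a b
    by (rule joined_trans[OF L into out])
qed

section \<open>One-parameter groups of matrices\<close>

lemma bounded_bilinear_matrix_mult:
  "bounded_bilinear ((**) :: real^'n^'n \<Rightarrow> real^'n^'n \<Rightarrow> real^'n^'n)"
  unfolding bilinear_conv_bounded_bilinear[symmetric] bilinear_def
  by (auto intro!: linearI simp: vec_eq_iff matrix_mult_nth algebra_simps sum.distrib
      sum_distrib_left)

interpretation matmul: bounded_bilinear "(**) :: real^'n^'n \<Rightarrow> real^'n^'n \<Rightarrow> real^'n^'n"
  by (rule bounded_bilinear_matrix_mult)

lemma has_vector_derivative_entrywise:
  fixes X :: "real \<Rightarrow> real^'n^'n"
  assumes "\<And>a b. ((\<lambda>t. X t $ a $ b) has_real_derivative D $ a $ b) (at t within S)"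
  shows "(X has_vector_derivative D) (at t within S)"
proof -
  have "((\<lambda>t. \<Sum>a\<in>UNIV. \<Sum>b\<in>UNIV. X t $ a $ b *\<^sub>R E_mat a b) has_vector_derivative
      (\<Sum>a\<in>UNIV. \<Sum>b\<in>UNIV. D $ a $ b *\<^sub>R E_mat a b)) (at t within S)"
    by (intro has_vector_derivative_sum)
       (use assms in \<open>auto intro!: derivative_eq_intros\<close>)
  then show ?thesis by (simp only: matrix_sum_E_mat[symmetric])
qed

primrec mpow :: "real^'n^'n \<Rightarrow> nat \<Rightarrow> real^'n^'n" where
  "mpow B 0 = mat 1"
| "mpow B (Suc k) = B ** mpow B k"

text \<open>The matrix exponential \<open>exp (t B)\<close>, given entrywise as a real power series in \<open>t\<close>; term-by-term
  differentiation of real power series then applies to each entry.\<close>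

definition mexp :: "real \<Rightarrow> real^'n^'n \<Rightarrow> real^'n^'n" where
  "mexp t B = (\<chi> a b. \<Sum>k. mpow B k $ a $ b / fact k * t ^ k)"

lemma mexp_nth: "mexp t B $ a $ b = (\<Sum>k. mpow B k $ a $ b / fact k * t ^ k)"
  by (simp add: mexp_def)

lemma mpow_Suc_right: "mpow B (Suc k) = mpow B k ** B"
  by (induction k) (simp_all add: matrix_mul_assoc)

lemma mpow_bound: "\<bar>mpow B k $ a $ b\<bar> \<le> (\<Sum>c\<in>UNIV. \<Sum>d\<in>UNIV. \<bar>B $ c $ d\<bar>) ^ k"
proof (induction k arbitrary: a b)
  case 0
  then show ?case by (simp add: mat_def)
next
  case (Suc k)
  let ?K = "\<Sum>c\<in>UNIV. \<Sum>d\<in>UNIV. \<bar>B $ c $ d\<bar>"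
  have "\<bar>mpow B (Suc k) $ a $ b\<bar> \<le> (\<Sum>d\<in>UNIV. \<bar>B $ a $ d\<bar> * \<bar>mpow B k $ d $ b\<bar>)"
    by (simp add: matrix_mult_nth abs_mult[symmetric] sum_abs)
  also have "\<dots> \<le> (\<Sum>d\<in>UNIV. \<bar>B $ a $ d\<bar> * ?K ^ k)"
    by (intro sum_mono mult_left_mono Suc.IH) simp
  also have "\<dots> \<le> ?K * ?K ^ k"
    unfolding sum_distrib_right[symmetric]
    by (intro mult_right_mono member_le_sum[where f = "\<lambda>c. \<Sum>d\<in>UNIV. \<bar>B $ c $ d\<bar>"])
       (auto intro!: sum_nonneg zero_le_power)
  finally show ?case by simp
qed

lemma summable_mexp: "summable (\<lambda>k. mpow B k $ a $ b / fact k * t ^ k)" for t :: real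
proof (rule summable_comparison_test')
  let ?K = "\<Sum>c\<in>UNIV. \<Sum>d\<in>UNIV. \<bar>B $ c $ d\<bar>"
  show "summable (\<lambda>k. inverse (fact k) * (?K * \<bar>t\<bar>) ^ k)" by (rule summable_exp)
  show "norm (mpow B k $ a $ b / fact k * t ^ k) \<le> inverse (fact k) * (?K * \<bar>t\<bar>) ^ k" for k
    using mult_right_mono[OF mpow_bound[of B k a b], of "\<bar>t\<bar> ^ k / fact k"]
    by (simp add: abs_mult power_abs power_mult_distrib field_simps)
qed

lemma mexp_0 [simp]: "mexp 0 B = mat 1"
proof -
  have "(\<Sum>k. mpow B k $ a $ b / fact k * 0 ^ k) = mat 1 $ a $ b" for a b
    using powser_zero[of "\<lambda>k. mpow B k $ a $ b / fact k"] by simp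
  then show ?thesis by (simp add: mexp_def vec_eq_iff)
qed

lemma mexp_mult_nth:
  "(B ** mexp t B) $ a $ b = (\<Sum>k. mpow B (Suc k) $ a $ b / fact k * t ^ k)"
  "(mexp t B ** B) $ a $ b = (\<Sum>k. mpow B (Suc k) $ a $ b / fact k * t ^ k)"
proof -
  have "(B ** mexp t B) $ a $ b = (\<Sum>c\<in>UNIV. \<Sum>k. B $ a $ c * (mpow B k $ c $ b / fact k * t ^ k))"
    by (simp only: matrix_mult_nth mexp_nth suminf_mult[OF summable_mexp])
  also have "\<dots> = (\<Sum>k. \<Sum>c\<in>UNIV. B $ a $ c * (mpow B k $ c $ b / fact k * t ^ k))"
    by (intro suminf_sum[symmetric] summable_mult summable_mexp)
  finally show "(B ** mexp t B) $ a $ b = (\<Sum>k. mpow B (Suc k) $ a $ b / fact k * t ^ k)"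
    by (simp only: mpow.simps matrix_mult_nth sum_divide_distrib sum_distrib_right mult.assoc
        times_divide_eq_right times_divide_eq_left)
  have "(mexp t B ** B) $ a $ b = (\<Sum>c\<in>UNIV. \<Sum>k. mpow B k $ a $ c / fact k * t ^ k * B $ c $ b)"
    by (simp only: matrix_mult_nth mexp_nth suminf_mult2[OF summable_mexp])
  also have "\<dots> = (\<Sum>k. \<Sum>c\<in>UNIV. mpow B k $ a $ c / fact k * t ^ k * B $ c $ b)"
    by (intro suminf_sum[symmetric] summable_mult2 summable_mexp)
  finally show "(mexp t B ** B) $ a $ b = (\<Sum>k. mpow B (Suc k) $ a $ b / fact k * t ^ k)"
    unfolding mpow_Suc_right
    by (subst matrix_mult_nth, subst sum_divide_distrib, subst sum_distrib_right) (simp add: mult_ac)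
qed

lemma mexp_commute: "B ** mexp t B = mexp t B ** B"
  by (simp add: vec_eq_iff mexp_mult_nth)

lemma mexp_has_vector_derivative:
  "((\<lambda>t. mexp t B) has_vector_derivative B ** mexp t B) (at t within S)"
proof (rule has_vector_derivative_entrywise)
  fix a b
  let ?c = "\<lambda>k. mpow B k $ a $ b / fact k"
  have "diffs ?c = (\<lambda>k. mpow B (Suc k) $ a $ b / fact k)"
    by (auto simp: diffs_def fun_eq_iff field_simps simp del: of_nat_Suc mpow.simps)
  then have "((\<lambda>t. \<Sum>k. ?c k * t ^ k) has_real_derivative (\<Sum>k. mpow B (Suc k) $ a $ b / fact k * t ^ k)) (at t)"
    using termdiffs_strong_converges_everywhere[OF summable_mexp[of B a b], of t] by simp
  then show "((\<lambda>t. mexp t B $ a $ b) has_real_derivative (B ** mexp t B) $ a $ b) (at t within S)"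
    by (simp only: mexp_mult_nth mexp_nth has_field_derivative_at_within)
qed

lemma mexp_shift_has_vector_derivative:
  "((\<lambda>t. mexp (c + t) B) has_vector_derivative B ** mexp (c + t) B) (at t within S)"
proof -
  have "((\<lambda>t. c + t) has_vector_derivative 1) (at t within S)"
    by (auto intro!: derivative_eq_intros)
  from vector_diff_chain_within[OF this mexp_has_vector_derivative] show ?thesis
    by (simp add: o_def)
qed

lemma mexp_minus_has_vector_derivative:
  "((\<lambda>t. mexp (- t) B) has_vector_derivative - (B ** mexp (- t) B)) (at t within S)"
proof -
  have "((\<lambda>t. - t) has_vector_derivative - 1) (at t within S)"
    by (auto intro!: derivative_eq_intros)
  from vector_diff_chain_within[OF this mexp_has_vector_derivative] show ?thesis
    by (simp add: o_def)
qed

lemma continuous_on_mexp: "continuous_on S (\<lambda>t. mexp t B)"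
  using mexp_has_vector_derivative
  by (auto intro!: continuous_at_imp_continuous_on has_vector_derivative_continuous)

text \<open>As a function of \<open>s\<close> the left-hand side has derivative zero. The inverse and the group law
  both follow from this one identity.\<close>

lemma mexp_minus_mult_mexp_add: "mexp (- s) B ** mexp (t + s) B = mexp t B"
proof -
  have "mexp (- s) B ** (B ** mexp (t + s) B) = (B ** mexp (- s) B) ** mexp (t + s) B" for s
    by (simp add: matrix_mul_assoc mexp_commute[of B "- s"])
  then have "((\<lambda>s. mexp (- s) B ** mexp (t + s) B) has_vector_derivative 0) (at s within UNIV)" for s
    using matmul.has_vector_derivative[OF mexp_minus_has_vector_derivative[of B s UNIV]
        mexp_shift_has_vector_derivative[of t B s UNIV]]
    by (simp only: matmul.minus_left add.right_inverse)
  then obtain C where "mexp (- s) B ** mexp (t + s) B = C" for s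
    by (rule has_vector_derivative_zero_constant[OF convex_UNIV]) auto
  from this[of s] this[of 0] show ?thesis by simp
qed

lemma mexp_inverse [simp]:
  "mexp t B ** mexp (- t) B = mat 1" "mexp (- t) B ** mexp t B = mat 1"
  using mexp_minus_mult_mexp_add[of t B 0] mexp_minus_mult_mexp_add[of "- t" B 0] by simp_all

lemma mexp_add: "mexp (s + t) B = mexp s B ** mexp t B"
proof -
  have "mexp s B ** mexp t B = mexp s B ** (mexp (- s) B ** mexp (t + s) B)"
    by (simp only: mexp_minus_mult_mexp_add)
  also have "\<dots> = mexp (t + s) B"
    by (simp only: matrix_mul_assoc mexp_inverse matrix_mul_lid)
  finally show ?thesis by (simp add: add.commute)
qed

text \<open>In the Leibniz formula a permutation other than the identity moves at least two points. Each term
  of the derivative of its product therefore still contains an off-diagonal entry of the identity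
  matrix, and only the identity permutation contributes.\<close>

lemma det_has_derivative_at_mat_1:
  fixes X :: "real \<Rightarrow> real^'n^'n"
  assumes X: "\<And>a b. ((\<lambda>t. X t $ a $ b) has_real_derivative D $ a $ b) (at 0)" and "X 0 = mat 1"
  shows "((\<lambda>t. det (X t)) has_real_derivative trace D) (at 0)"
proof -
  let ?P = "{p. p permutes (UNIV :: 'n set)}"
  let ?d = "\<lambda>p. of_int (sign p) * (\<Sum>a\<in>UNIV. D $ a $ p a * (\<Prod>b\<in>UNIV - {a}. X 0 $ b $ p b))"
  have "((\<lambda>t. det (X t)) has_real_derivative (\<Sum>p\<in>?P. ?d p)) (at 0)"
    unfolding det_def by (intro DERIV_sum DERIV_cmult has_field_derivative_prod X)
  also have "(\<Sum>p\<in>?P. ?d p) = (\<Sum>p\<in>?P. if p = id then trace D else 0)"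
  proof (rule sum.cong[OF refl])
    fix p assume p: "p \<in> ?P"
    show "?d p = (if p = id then trace D else 0)"
    proof (cases "p = id")
      case True
      then show ?thesis using assms(2) by (simp add: mat_def trace_def)
    next
      case False
      have "(\<Prod>b\<in>UNIV - {a}. X 0 $ b $ p b) = 0" for a
      proof -
        obtain b where b: "p b \<noteq> b" using False by (auto simp: fun_eq_iff)
        then have "p (p b) \<noteq> p b" using p permutes_inj by (metis (no_types) injD mem_Collect_eq)
        with b obtain c where "c \<noteq> a" "p c \<noteq> c" by metis
        then show ?thesis using assms(2) by (auto simp: mat_def intro!: bexI[of _ c])
      qed
      then have "?d p = 0" by (simp only: mult_zero_right sum.neutral_const)
      with False show ?thesis by simp
    qed
  qed
  also have "\<dots> = trace D"
    by (simp add: permutes_id finite_permutations)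
  finally show ?thesis .
qed

text \<open>By the group law, the derivative of the determinant along the group at any time is a multiple of
  its derivative at time zero, which is the trace of \<open>B\<close>.\<close>

lemma det_mexp:
  assumes "trace B = 0"
  shows "det (mexp t B) = 1"
proof -
  have entries: "((\<lambda>t. mexp t B $ a $ b) has_real_derivative B $ a $ b) (at 0)" for a b
    using mexp_has_vector_derivative[of B 0 UNIV]
    by (auto simp: has_real_derivative_iff_has_vector_derivative
        intro: bounded_linear.has_vector_derivative[OF bounded_linear_vec_nth])
  have at_0: "((\<lambda>h. det (mexp h B)) has_real_derivative 0) (at 0)"
    using det_has_derivative_at_mat_1[of "\<lambda>t. mexp t B", OF entries] assms by simp
  have "((\<lambda>s. det (mexp s B)) has_real_derivative 0) (at s)" for s
  proof -
    have "((\<lambda>h. det (mexp s B) * det (mexp h B)) has_real_derivative 0) (at 0)"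
      using DERIV_cmult[OF at_0, of "det (mexp s B)"] by simp
    then have "((\<lambda>h. det (mexp (s + h) B)) has_real_derivative 0) (at 0)"
      by (simp add: mexp_add det_mul)
    then show ?thesis
      using DERIV_shift[of "\<lambda>s. det (mexp s B)" 0 0 s] by (simp add: add.commute)
  qed
  then have "det (mexp t B) = det (mexp 0 B)"
    by (intro DERIV_isconst_all) auto
  then show ?thesis by simp
qed

lemma det_scaleR: "det (c *\<^sub>R X) = c ^ CARD('n) * det X" for X :: "real^'n^'n"
  by (simp add: det_def prod.distrib sum_distrib_left mult_ac)

section \<open>Concatenation of controls\<close>

definition admissible :: "real^'n^'n \<Rightarrow> nat \<Rightarrow> nat \<Rightarrow> (nat \<Rightarrow> 'n) \<Rightarrow> (nat \<Rightarrow> 'n) \<Rightarrow> (real^'n^'n) set" where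
  "admissible A m1 m2 i j = range (\<lambda>w. A + control_matrix m1 m2 i j w)"

lemma trace_E_mat: "trace (E_mat a b) = (if a = b then 1 else 0)"
  by (auto simp: trace_def E_mat_nth intro: sum.neutral)

lemma trace_linear: "linear (trace :: real^'n^'n \<Rightarrow> real)"
  by (rule linearI) (simp_all add: trace_def sum.distrib sum_distrib_left)

lemma trace_admissible:
  assumes "A \<in> sl" and "m1 \<le> m2" and "\<forall>k\<in>{1..m2}. i k \<noteq> j k" and "B \<in> admissible A m1 m2 i j"
  shows "trace B = 0"
proof -
  obtain w where w: "B = A + control_matrix m1 m2 i j w"
    using assms(4) by (auto simp: admissible_def)
  have "trace (\<Sum>k = 1..m1. w k *\<^sub>R E_mat (i k) (j k)) = (\<Sum>k = 1..m1. w k *\<^sub>R trace (E_mat (i k) (j k)))"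
    by (simp only: linear_sum[OF trace_linear] linear_cmul[OF trace_linear])
  also have "\<dots> = 0"
    using assms(2,3) by (intro sum.neutral) (auto simp: trace_E_mat)
  finally have E: "trace (\<Sum>k = 1..m1. w k *\<^sub>R E_mat (i k) (j k)) = 0" .
  have "trace (\<Sum>k = m1+1..m2. w k *\<^sub>R C_mat (i k) (j k)) = (\<Sum>k = m1+1..m2. w k *\<^sub>R trace (C_mat (i k) (j k)))"
    by (simp only: linear_sum[OF trace_linear] linear_cmul[OF trace_linear])
  also have "\<dots> = 0"
    by (simp add: C_mat_def trace_sub trace_E_mat)
  finally show ?thesis
    using E assms(1) by (simp add: w control_matrix_def trace_add sl_def)
qed

lemma piecewise_constant_on_append:
  assumes "piecewise_constant_on {0..T} u"
  shows "piecewise_constant_on {0..T + t} (\<lambda>s. if s \<le> T then u s else c)"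
proof -
  obtain S where "finite S" and S: "\<And>I. is_interval I \<Longrightarrow> I \<subseteq> {0..T} - S \<Longrightarrow> u constant_on I"
    using assms unfolding piecewise_constant_on_def by blast
  have "(\<lambda>s. if s \<le> T then u s else c) constant_on I"
    if I: "is_interval I" "I \<subseteq> {0..T + t} - insert T S" for I
  proof (cases "\<exists>s\<in>I. s < T")
    case True
    then obtain s where "s \<in> I" "s < T" by blast
    moreover have "T \<notin> I" using I by auto
    ultimately have below: "r < T" if "r \<in> I" for r
      using I(1) that unfolding is_interval_1 by (meson less_imp_le linorder_not_less)
    then have "I \<subseteq> {0..T} - S" using I(2) by (auto simp: less_imp_le)
    from S[OF I(1) this] obtain d where d: "\<And>r. r \<in> I \<Longrightarrow> u r = d" by (auto simp: constant_on_def)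
    show ?thesis
      unfolding constant_on_def using d below by (intro exI[of _ d]) (simp add: less_imp_le)
  next
    case False
    then have above: "T < s" if "s \<in> I" for s
      using that I(2) by (metis Diff_iff insertI1 linorder_neqE_linordered_idom subsetD)
    show ?thesis
      unfolding constant_on_def by (intro exI[of _ c]) (use above in \<open>auto dest: leD\<close>)
  qed
  then show ?thesis
    unfolding piecewise_constant_on_def using \<open>finite S\<close> by (intro exI[of _ "insert T S"]) auto
qed

text \<open>Append to a given control the constant control that produces \<open>B\<close>. The junction time joins the
  finitely many exceptional times.\<close>

lemma reachable_set_mexp:
  assumes g: "g \<in> reachable_set A m1 m2 i j" and B: "B \<in> admissible A m1 m2 i j"
    and "trace B = 0" and "0 \<le> t"
  shows "mexp t B ** g \<in> reachable_set A m1 m2 i j"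
proof -
  obtain T X u where "0 \<le> T" and u: "\<forall>k\<in>{1..m2}. piecewise_constant_on {0..T} (u k)"
    and sol: "is_solution A m1 m2 i j u T X" and X: "X 0 = mat 1" "X T = g"
    using g unfolding reachable_set_def reachable_at_def by (auto simp del: atLeastAtMost_iff)
  obtain w where w: "B = A + control_matrix m1 m2 i j w" using B by (auto simp: admissible_def)
  define Y where "Y s = mexp (- T + s) B ** g" for s
  define X' where "X' s = (if s \<le> T then X s else Y s)" for s
  define u' where "u' k s = (if s \<le> T then u k s else w k)" for k s
  obtain S where "finite S" and S: "\<And>s. s \<in> {0..T} - S \<Longrightarrow>
      (X has_vector_derivative (A ** X s + control_matrix m1 m2 i j (\<lambda>k. u k s) ** X s)) (at s within {0..T})"
    and cont: "continuous_on {0..T} X" and SL: "X ` {0..T} \<subseteq> SL"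
    using sol unfolding is_solution_def by auto
  have Y_deriv: "(Y has_vector_derivative A ** Y s + control_matrix m1 m2 i j w ** Y s) (at s within D)" for s D
  proof -
    have "(Y has_vector_derivative (B ** mexp (- T + s) B) ** g) (at s within D)"
      unfolding Y_def
      by (rule bounded_linear.has_vector_derivative[OF matmul.bounded_linear_left
            mexp_shift_has_vector_derivative])
    then show ?thesis by (simp add: w Y_def matmul.add_left matrix_mul_assoc)
  qed
  have "continuous_on D Y" for D
    using Y_deriv by (auto intro!: continuous_at_imp_continuous_on has_vector_derivative_continuous)
  then have "continuous_on {0..T + t} X'"
    unfolding X'_def using \<open>0 \<le> t\<close> X
    by (intro continuous_on_cases_le continuous_on_subset[OF cont]) (auto simp: Y_def)
  moreover have "X' ` {0..T + t} \<subseteq> SL"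
  proof -
    have "X T \<in> SL" using SL \<open>0 \<le> T\<close> by (simp add: image_subset_iff)
    then have "det g = 1" using X(2) by (simp add: SL_def)
    then show ?thesis
      using SL \<open>trace B = 0\<close> by (auto simp: X'_def Y_def SL_def image_subset_iff det_mul det_mexp)
  qed
  moreover have "(X' has_vector_derivative
      (A ** X' s + control_matrix m1 m2 i j (\<lambda>k. u' k s) ** X' s)) (at s within {0..T + t})"
    if s: "s \<in> {0..T + t} - insert T S" for s
  proof (cases "s < T")
    case True
    have "at s within {0..T} = at s within {0..T + t}"
      by (rule at_within_nhd[of _ "{..<T}"]) (use True \<open>0 \<le> t\<close> in auto)
    moreover have "(X has_vector_derivative
        (A ** X s + control_matrix m1 m2 i j (\<lambda>k. u k s) ** X s)) (at s within {0..T})"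
      using S s True by auto
    ultimately have "(X has_vector_derivative
        (A ** X' s + control_matrix m1 m2 i j (\<lambda>k. u' k s) ** X' s)) (at s within {0..T + t})"
      using True by (simp add: X'_def u'_def)
    then show ?thesis
      by (rule has_vector_derivative_transform_within[where d = "T - s"])
         (use s True in \<open>auto simp: X'_def dist_real_def\<close>)
  next
    case False
    with s have "T < s" by auto
    then have "(Y has_vector_derivative
        (A ** X' s + control_matrix m1 m2 i j (\<lambda>k. u' k s) ** X' s)) (at s within {0..T + t})"
      using Y_deriv[of s] by (simp add: X'_def u'_def)
    then show ?thesis
      by (rule has_vector_derivative_transform_within[where d = "s - T"])
         (use s \<open>T < s\<close> in \<open>auto simp: X'_def dist_real_def\<close>)
  qed
  ultimately have "is_solution A m1 m2 i j u' (T + t) X'"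
    unfolding is_solution_def using \<open>finite S\<close> by (intro conjI exI[of _ "insert T S"]) auto
  moreover have "piecewise_constant_on {0..T + t} (u' k)" if "k \<in> {1..m2}" for k
    unfolding u'_def using piecewise_constant_on_append[of T "u k" t "w k"] u that by blast
  moreover have "X' 0 = mat 1" using X \<open>0 \<le> T\<close> by (simp add: X'_def)
  ultimately have "X' (T + t) \<in> reachable_at A m1 m2 i j (T + t)"
    unfolding reachable_at_def by blast
  moreover have "X' (T + t) = mexp t B ** g"
    using X \<open>0 \<le> t\<close> by (cases "t = 0") (auto simp: X'_def Y_def)
  ultimately show ?thesis
    unfolding reachable_set_def using \<open>0 \<le> T\<close> \<open>0 \<le> t\<close> by auto
qed

lemma mat_1_reachable: "mat 1 \<in> reachable_set A m1 m2 i j"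
proof -
  \<comment> \<open>On an interval of length zero the only instant may be exceptional.\<close>
  have "is_solution A m1 m2 i j (\<lambda>_ _. 0) 0 (\<lambda>_. mat 1)"
    unfolding is_solution_def by (auto simp: SL_def intro!: exI[of _ "{0}"])
  moreover have "piecewise_constant_on {0..0} (\<lambda>_. 0)"
    by (auto simp: piecewise_constant_on_def constant_on_def)
  ultimately have "mat 1 \<in> reachable_at A m1 m2 i j 0"
    unfolding reachable_at_def by fastforce
  then show ?thesis by (auto simp: reachable_set_def)
qed

lemma reachable_set_subset_SL: "reachable_set A m1 m2 i j \<subseteq> SL"
  by (auto simp: reachable_set_def reachable_at_def is_solution_def)

section \<open>Directions attained at reachable points\<close>

text \<open>All that the argument needs to know about the reachable set \<open>R\<close> is that it contains the identity
  and is stable under left multiplication by the forward flows of the right-hand sides in \<open>\<B>\<close>.\<close>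

locale exp_closed =
  fixes \<B> R :: "(real^'n^'n) set"
  assumes mat_1_in: "mat 1 \<in> R"
    and mexp_in: "g \<in> R \<Longrightarrow> B \<in> \<B> \<Longrightarrow> 0 \<le> t \<Longrightarrow> mexp t B ** g \<in> R"
begin

text \<open>The point \<open>g\<close> lies on a family \<open>\<Phi>\<close> of points of \<open>R\<close> whose velocities at \<open>g\<close>, translated back to
  the identity, fill the subspace \<open>W\<close>. The family is parametrised by all matrices and not by a list
  of times of variable length: every subspace that occurs is the range of a linear map on matrices,
  so a single parameter space suffices.\<close>

definition attained :: "(real^'n^'n) set \<Rightarrow> real^'n^'n \<Rightarrow> bool" where
  "attained W g \<longleftrightarrow> (\<exists>\<Phi> \<psi> :: real^'n^'n \<Rightarrow> real^'n^'n. linear \<psi> \<and> range \<psi> = W \<and> continuous_on UNIV \<Phi> \<and> \<Phi> 0 = g \<and>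
     (\<Phi> has_derivative (\<lambda>Y. \<psi> Y ** g)) (at 0) \<and> (\<forall>\<^sub>F Y in nhds 0. \<Phi> Y \<in> R))"

lemma attained_subspace: "attained W g \<Longrightarrow> subspace W"
  unfolding attained_def by (auto intro: linear_subspace_image)

lemma attained_0: "attained {0} (mat 1)"
  unfolding attained_def
  by (rule exI[of _ "\<lambda>_. mat 1"], rule exI[of _ "\<lambda>_. 0"]) (auto simp: mat_1_in linear_iff)

end

definition conj_mexp :: "real \<Rightarrow> real^'n^'n \<Rightarrow> real^'n^'n \<Rightarrow> real^'n^'n" where
  "conj_mexp t B X = mexp t B ** X ** mexp (- t) B"

lemma linear_conj_mexp: "linear (conj_mexp t B)"
  by (rule linearI) (simp_all add: conj_mexp_def matmul.add_left matmul.add_right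
      matmul.scaleR_left matmul.scaleR_right)

lemma conj_mexp_inverse: "conj_mexp (- t) B (conj_mexp t B X) = X"
proof -
  have "conj_mexp (- t) B (conj_mexp t B X) =
      (mexp (- t) B ** mexp t B) ** X ** (mexp (- t) B ** mexp t B)"
    by (simp only: conj_mexp_def matrix_mul_assoc minus_minus)
  then show ?thesis by simp
qed

lemma conj_mexp_mult: "conj_mexp t B X ** (mexp t B ** g) = mexp t B ** X ** g"
proof -
  have "conj_mexp t B X ** (mexp t B ** g) = mexp t B ** X ** (mexp (- t) B ** mexp t B) ** g"
    by (simp only: conj_mexp_def matrix_mul_assoc)
  then show ?thesis by simp
qed

lemma linear_comm: "linear (comm X)"
  by (rule linearI) (simp_all add: comm_def matmul.add_left matmul.add_right matmul.scaleR_left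
      matmul.scaleR_right scaleR_diff_right)

lemma tendsto_0_linear:
  fixes f :: "'a::euclidean_space \<Rightarrow> 'b::real_normed_vector"
  assumes "linear f"
  shows "(f \<longlongrightarrow> 0) (nhds 0)"
proof -
  have "isCont f 0"
    using assms by (simp add: linear_continuous_at linear_conv_bounded_linear)
  then have "(f \<longlongrightarrow> f 0) (nhds 0)"
    by (simp only: isCont_def tendsto_at_iff_tendsto_nhds)
  then show ?thesis by (simp only: linear_0[OF assms])
qed

text \<open>A subspace of finite dimension is closed, and the difference quotients lie in it.\<close>

lemma vector_derivative_in_subspace:
  fixes \<gamma> :: "real \<Rightarrow> 'a::euclidean_space"
  assumes deriv: "(\<gamma> has_vector_derivative D) (at 0 within {0<..})"
    and V: "subspace V" and \<gamma>: "\<And>t. 0 \<le> t \<Longrightarrow> \<gamma> t \<in> V"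
  shows "D \<in> V"
proof (rule Lim_in_closed_set)
  let ?e = "\<lambda>t. (1 / norm (t - 0)) *\<^sub>R (\<gamma> t - (\<gamma> 0 + (t - 0) *\<^sub>R D))"
  have "(?e \<longlongrightarrow> 0) (at 0 within {0<..})"
    using deriv unfolding has_vector_derivative_def has_derivative_within by blast
  then show "((\<lambda>t. ?e t + D) \<longlongrightarrow> D) (at 0 within {0<..})"
    using tendsto_add[OF _ tendsto_const[of D]] by fastforce
  have "?e t + D \<in> V" if "0 < t" for t
  proof -
    have "?e t + D = (1 / t) *\<^sub>R (\<gamma> t - \<gamma> 0)"
      using that by (simp add: scaleR_diff_right scaleR_add_right)
    then show ?thesis using V \<gamma> that by (simp add: subspace_diff subspace_scale)
  qed
  then show "\<forall>\<^sub>F t in at 0 within {0<..}. ?e t + D \<in> V"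
    by (simp add: eventually_at_filter)
qed (use V in \<open>auto simp: closed_subspace\<close>)

lemma linear_right_inverse_on_range:
  fixes \<psi> :: "'a::real_vector \<Rightarrow> 'b::real_vector"
  assumes "linear \<psi>"
  obtains q where "linear q" and "\<And>w. w \<in> range \<psi> \<Longrightarrow> \<psi> (q w) = w"
  using real_vector.linear_exists_right_inverse_on[OF assms real_vector.subspace_UNIV] by auto

text \<open>The coefficient of \<open>b\<close> relative to \<open>W\<close>. When \<open>b\<close> already lies in \<open>W\<close>, the zero functional serves,
  so both cases can be handled alike.\<close>

lemma linear_functional_modulo:
  fixes W :: "'a::real_vector set"
  assumes W: "subspace W"
  obtains \<mu> :: "'a \<Rightarrow> real" where "linear \<mu>" and "\<And>w. w \<in> W \<Longrightarrow> \<mu> w = 0" and "b - \<mu> b *\<^sub>R b \<in> W"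
proof (cases "b \<in> W")
  case True
  then show thesis using that[of "\<lambda>_. 0"] by (simp add: linear_iff)
next
  case False
  obtain C where C: "C \<subseteq> W" "independent C" "W \<subseteq> span C" "span C = W"
    using maximal_independent_subset[of W] W by (metis span_minimal subset_antisym)
  with False have "independent (insert b C)" "b \<notin> C" by (auto simp: independent_insert)
  then obtain \<mu> :: "'a \<Rightarrow> real" where \<mu>: "linear \<mu>" "\<And>x. x \<in> insert b C \<Longrightarrow> \<mu> x = (if x = b then 1 else 0)"
    using linear_independent_extend[of "insert b C" "\<lambda>x. if x = b then 1 else 0 :: real"] by blast
  have "\<mu> x = 0" if "x \<in> C" for x
    using \<mu>(2)[of x] \<open>b \<notin> C\<close> that by auto
  then have "\<mu> w = 0" if "w \<in> W" for w
    using linear_eq_0_on_span[OF \<mu>(1), of C w] C(4) that by simp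
  moreover have "\<mu> b = 1" using \<mu>(2) by simp
  ultimately show thesis using that[of \<mu>] \<mu>(1) W by (simp add: subspace_0)
qed

context exp_closed
begin

text \<open>Multiply the family by \<open>exp (s B)\<close>, where the time \<open>s\<close> varies around \<open>t\<close>. The parameter \<open>Y\<close> is split
  into its \<open>B\<close>-component \<open>\<mu> Y\<close>, which perturbs the time, and a remainder that is fed into the given
  family. As \<open>t\<close> is positive, the perturbed times near \<open>t\<close> remain positive, so the family stays
  in \<open>R\<close>.\<close>

lemma attained_extend:
  assumes "attained W g" and B: "B \<in> \<B>" and t: "0 < t"
  shows "attained (conj_mexp t B ` span (insert B W)) (mexp t B ** g)"
proof -
  obtain \<Phi> \<psi> :: "real^'n^'n \<Rightarrow> real^'n^'n" where \<psi>: "linear \<psi>" "range \<psi> = W" and cont: "continuous_on UNIV \<Phi>"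
    and \<Phi>: "\<Phi> 0 = g" "(\<Phi> has_derivative (\<lambda>Y. \<psi> Y ** g)) (at 0)" "\<forall>\<^sub>F Y in nhds 0. \<Phi> Y \<in> R"
    using assms(1) unfolding attained_def by blast
  obtain q where q: "linear q" "\<And>w. w \<in> W \<Longrightarrow> \<psi> (q w) = w"
    using linear_right_inverse_on_range[OF \<psi>(1)] \<psi>(2) by metis
  obtain \<mu> :: "real^'n^'n \<Rightarrow> real" where \<mu>: "linear \<mu>" "\<And>w. w \<in> W \<Longrightarrow> \<mu> w = 0" "B - \<mu> B *\<^sub>R B \<in> W"
    using linear_functional_modulo[OF attained_subspace[OF assms(1)]] by blast
  have W: "subspace W" by (rule attained_subspace[OF assms(1)])
  define p where "p Y = q (Y - \<mu> Y *\<^sub>R B)" for Y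
  \<comment> \<open>A projection onto the span of \<open>insert B W\<close>.\<close>
  define \<omega> where "\<omega> Y = \<mu> Y *\<^sub>R B + \<psi> (p Y)" for Y
  define \<Phi>' where "\<Phi>' Y = mexp (t + \<mu> Y) B ** \<Phi> (p Y)" for Y
  have p: "linear p"
    unfolding p_def
    by (rule linearI) (simp_all add: linear_add[OF \<mu>(1)] linear_cmul[OF \<mu>(1)] linear_add[OF q(1)]
        linear_diff[OF q(1)] linear_cmul[OF q(1)] algebra_simps)
  have \<omega>: "linear \<omega>"
    unfolding \<omega>_def
    by (rule linearI) (simp_all add: linear_add[OF \<mu>(1)] linear_cmul[OF \<mu>(1)] linear_add[OF p]
        linear_cmul[OF p] linear_add[OF \<psi>(1)] linear_cmul[OF \<psi>(1)] algebra_simps)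
  have range_\<omega>: "range \<omega> = span (insert B W)"
  proof (intro subset_antisym subsetI)
    fix Z assume "Z \<in> range \<omega>"
    then show "Z \<in> span (insert B W)"
      using \<psi>(2) by (auto simp: \<omega>_def intro!: span_add span_scale intro: span_base)
  next
    fix Z assume "Z \<in> span (insert B W)"
    then obtain c where "Z - c *\<^sub>R B \<in> W"
      using W by (auto simp: span_insert span_eq_iff[THEN iffD2])
    then have "\<mu> (Z - c *\<^sub>R B) = 0" by (rule \<mu>(2))
    then have \<mu>Z: "\<mu> Z = c * \<mu> B" by (simp add: linear_diff[OF \<mu>(1)] linear_cmul[OF \<mu>(1)])
    have "Z - \<mu> Z *\<^sub>R B = (Z - c *\<^sub>R B) + c *\<^sub>R (B - \<mu> B *\<^sub>R B)"
      by (simp add: \<mu>Z algebra_simps)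
    also have "\<dots> \<in> W"
      using W \<open>Z - c *\<^sub>R B \<in> W\<close> \<mu>(3) by (intro subspace_add subspace_scale)
    finally have "\<psi> (p Z) = Z - \<mu> Z *\<^sub>R B" unfolding p_def by (rule q(2))
    then have "Z = \<omega> Z" by (simp add: \<omega>_def)
    then show "Z \<in> range \<omega>" by blast
  qed
  have "linear (conj_mexp t B \<circ> \<omega>)"
    by (rule linear_compose[OF \<omega> linear_conj_mexp])
  moreover have "range (conj_mexp t B \<circ> \<omega>) = conj_mexp t B ` span (insert B W)"
    by (simp only: image_comp[symmetric] range_\<omega>)
  moreover have bl: "bounded_linear \<mu>" "bounded_linear p"
    using \<mu>(1) p by (simp_all add: linear_conv_bounded_linear)
  have "continuous_on UNIV \<Phi>'"
    unfolding \<Phi>'_def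
  proof (rule matmul.continuous_on)
    show "continuous_on UNIV (\<lambda>Y. mexp (t + \<mu> Y) B)"
      by (rule continuous_on_compose2[OF continuous_on_mexp[of UNIV]
            continuous_on_add[OF continuous_on_const linear_continuous_on[OF bl(1)]]]) simp
    show "continuous_on UNIV (\<lambda>Y. \<Phi> (p Y))"
      by (rule continuous_on_compose2[OF cont]) (auto intro!: linear_continuous_on bl)
  qed
  moreover have zero: "\<mu> 0 = 0" "p 0 = 0" by (simp_all add: linear_0[OF \<mu>(1)] linear_0[OF p])
  then have "\<Phi>' 0 = mexp t B ** g" by (simp add: \<Phi>'_def \<Phi>(1))
  moreover have "(\<Phi>' has_derivative (\<lambda>Y. (conj_mexp t B \<circ> \<omega>) Y ** (mexp t B ** g))) (at 0)"
  proof -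
    have "((\<lambda>Y. t + \<mu> Y) has_derivative \<mu>) (at 0)"
      by (auto intro!: derivative_eq_intros bounded_linear_imp_has_derivative bl)
    moreover have "((\<lambda>s. mexp s B) has_derivative (\<lambda>h. h *\<^sub>R (B ** mexp t B))) (at (t + \<mu> 0))"
      using mexp_has_vector_derivative[of B t UNIV] by (simp add: has_vector_derivative_def zero)
    ultimately have E: "((\<lambda>Y. mexp (t + \<mu> Y) B) has_derivative (\<lambda>Y. \<mu> Y *\<^sub>R (B ** mexp t B))) (at 0)"
      by (rule has_derivative_compose)
    have "(p has_derivative p) (at 0)"
      by (rule bounded_linear_imp_has_derivative[OF bl(2)])
    moreover have "(\<Phi> has_derivative (\<lambda>Y. \<psi> Y ** g)) (at (p 0))"
      using \<Phi>(2) by (simp add: zero)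
    ultimately have F: "((\<lambda>Y. \<Phi> (p Y)) has_derivative (\<lambda>Y. \<psi> (p Y) ** g)) (at 0)"
      by (rule has_derivative_compose)
    have "mexp (t + \<mu> 0) B ** (\<psi> (p Y) ** g) + \<mu> Y *\<^sub>R (B ** mexp t B) ** \<Phi> (p 0)
        = (conj_mexp t B \<circ> \<omega>) Y ** (mexp t B ** g)" for Y
      unfolding o_apply conj_mexp_mult
      by (simp add: zero \<Phi>(1) \<omega>_def mexp_commute matmul.add_left matmul.add_right
          matmul.scaleR_left matmul.scaleR_right matrix_mul_assoc)
    then show ?thesis
      using matmul.FDERIV[OF E F] unfolding \<Phi>'_def by (simp only:)
  qed
  moreover have "\<forall>\<^sub>F Y in nhds 0. \<Phi>' Y \<in> R"
  proof -
    have "((\<lambda>Y. t + \<mu> Y) \<longlongrightarrow> t + 0) (nhds 0)"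
      by (intro tendsto_add tendsto_const tendsto_0_linear \<mu>(1))
    then have "\<forall>\<^sub>F Y in nhds 0. 0 < t + \<mu> Y"
      using t by (auto dest: order_tendstoD(1))
    moreover have "\<forall>\<^sub>F Y in nhds 0. \<Phi> (p Y) \<in> R"
      by (rule eventually_compose_filterlim[OF \<Phi>(3) tendsto_0_linear[OF p]])
    ultimately show ?thesis
      unfolding \<Phi>'_def by eventually_elim (simp add: mexp_in B)
  qed
  ultimately show ?thesis unfolding attained_def by blast
qed

definition maximal :: "(real^'n^'n) set \<Rightarrow> bool" where
  "maximal W \<longleftrightarrow> (\<exists>g. attained W g) \<and> (\<forall>W' g'. attained W' g' \<longrightarrow> dim W' \<le> dim W)"

lemma maximal_exists: "\<exists>W. maximal W"
proof -
  let ?P = "\<lambda>W. \<exists>g. attained W g"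
  have "\<exists>W. ?P W \<and> (\<forall>W'. ?P W' \<longrightarrow> dim W' \<le> dim W)"
  proof (rule ex_has_greatest_nat)
    show "?P {0}" using attained_0 by blast
    show "\<forall>W. ?P W \<longrightarrow> dim W < Suc DIM(real^'n^'n)"
      by (simp only: less_Suc_eq_le dim_subset_UNIV simp_thms)
  qed
  then show ?thesis unfolding maximal_def by blast
qed

lemma dim_conj_mexp: "dim (conj_mexp t B ` W) = dim W"
  by (rule dim_image_eq[OF linear_conj_mexp]) (metis conj_mexp_inverse inj_onI)

text \<open>A matrix \<open>B\<close> outside \<open>W\<close> would raise the dimension by one when its flow is appended, since
  conjugation preserves dimensions.\<close>

lemma maximal_contains:
  assumes W: "maximal W" and B: "B \<in> \<B>"
  shows "B \<in> W"
proof (rule ccontr)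
  assume "B \<notin> W"
  obtain g where g: "attained W g" using W by (auto simp: maximal_def)
  then have "B \<notin> span W"
    using \<open>B \<notin> W\<close> attained_subspace by (metis span_eq_iff)
  then have "dim (conj_mexp 1 B ` span (insert B W)) = dim W + 1"
    by (simp add: dim_conj_mexp dim_insert)
  moreover have "dim (conj_mexp 1 B ` span (insert B W)) \<le> dim W"
    using W attained_extend[OF g B, of 1] by (auto simp: maximal_def)
  ultimately show False by simp
qed

text \<open>Appending the flow of a matrix that already lies in \<open>W\<close> only conjugates \<open>W\<close>.\<close>

lemma maximal_conj_mexp:
  assumes W: "maximal W" and B: "B \<in> \<B>" and t: "0 < t"
  shows "maximal (conj_mexp t B ` W)"
proof -
  obtain g where g: "attained W g" using W by (auto simp: maximal_def)
  have "insert B W = W" using maximal_contains[OF W B] by blast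
  moreover have "span W = W" using attained_subspace[OF g] by (simp add: span_eq_iff)
  ultimately have "attained (conj_mexp t B ` W) (mexp t B ** g)"
    using attained_extend[OF g B t] by (simp only:)
  with W show ?thesis by (auto simp: maximal_def dim_conj_mexp)
qed

text \<open>The conjugates of elements of \<open>\<B>\<close> by backward flows. Forward flows act on the maximal spaces, and
  membership in all of these is inherited through the inverse conjugations.\<close>

inductive_set conj_orbit :: "(real^'n^'n) set" where
  base: "B \<in> \<B> \<Longrightarrow> B \<in> conj_orbit"
| conj: "v \<in> conj_orbit \<Longrightarrow> C \<in> \<B> \<Longrightarrow> 0 < t \<Longrightarrow> conj_mexp (- t) C v \<in> conj_orbit"

lemma conj_orbit_maximal: "v \<in> conj_orbit \<Longrightarrow> maximal W \<Longrightarrow> v \<in> W"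
proof (induction arbitrary: W rule: conj_orbit.induct)
  case (base B)
  then show ?case by (rule maximal_contains[rotated])
next
  case (conj v C t)
  then have "v \<in> conj_mexp t C ` W" using maximal_conj_mexp by blast
  then show ?case by (auto simp: conj_mexp_inverse)
qed

text \<open>Conjugation by \<open>exp (- t C)\<close> keeps the orbit inside itself for \<open>t > 0\<close>, and its derivative at
  \<open>t = 0\<close> is minus the commutator with \<open>C\<close>.\<close>

lemma comm_span_conj_orbit:
  assumes C: "C \<in> \<B>" and v: "v \<in> span conj_orbit"
  shows "comm C v \<in> span conj_orbit"
  using v
proof (induction rule: span_induct)
  case base
  show ?case
    using linear_subspace_vimage[OF linear_comm subspace_span] by (simp only: vimage_def)
next
  case (step v)
  let ?\<gamma> = "\<lambda>t. conj_mexp (- t) C v"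
  have "(?\<gamma> has_vector_derivative (mexp (- 0) C ** v) ** (C ** mexp 0 C) + (- (C ** mexp (- 0) C) ** v) ** mexp 0 C)
      (at 0 within {0<..})"
    unfolding conj_mexp_def minus_minus
    by (intro matmul.has_vector_derivative mexp_has_vector_derivative
        bounded_linear.has_vector_derivative[OF matmul.bounded_linear_left mexp_minus_has_vector_derivative])
  then have "(?\<gamma> has_vector_derivative - comm C v) (at 0 within {0<..})"
    by (simp add: comm_def matmul.minus_left)
  moreover have "?\<gamma> t \<in> span conj_orbit" if "0 \<le> t" for t
    using that step C conj_orbit.conj[of v C t]
    by (cases "t = 0") (auto simp: conj_mexp_def[of 0] intro: span_base)
  ultimately have "- comm C v \<in> span conj_orbit"
    by (rule vector_derivative_in_subspace[OF _ subspace_span])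
  then show ?case by (metis minus_minus span_neg)
qed

text \<open>Let \<open>V\<close> be the span of the orbit. The matrices whose commutator with \<open>V\<close> stays in \<open>V\<close> form a Lie
  algebra by the Jacobi identity, and so do those of them that lie in \<open>V\<close>. All of \<open>\<B>\<close> is among
  these.\<close>

lemma maximal_contains_lie_subalgebra:
  assumes "maximal W"
  obtains L where "lie_subalgebra L" and "\<B> \<subseteq> L" and "L \<subseteq> W"
proof
  let ?V = "span conj_orbit"
  let ?L = "{X \<in> ?V. \<forall>v \<in> ?V. comm X v \<in> ?V}"
  have "subspace ?L"
  proof (rule subspaceI)
    show "0 \<in> ?L" by (simp add: comm_def span_0)
  next
    fix X Y assume "X \<in> ?L" "Y \<in> ?L"
    moreover have "comm (X + Y) v = comm X v + comm Y v" for v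
      by (simp add: comm_def matmul.add_left matmul.add_right)
    ultimately show "X + Y \<in> ?L" by (simp add: span_add)
  next
    fix c X assume "X \<in> ?L"
    moreover have "comm (c *\<^sub>R X) v = c *\<^sub>R comm X v" for v
      by (simp add: comm_def matmul.scaleR_left matmul.scaleR_right scaleR_diff_right)
    ultimately show "c *\<^sub>R X \<in> ?L" by (simp add: span_scale)
  qed
  moreover have "comm X Y \<in> ?L" if X: "X \<in> ?L" and Y: "Y \<in> ?L" for X Y
  proof -
    have "comm (comm X Y) v \<in> ?V" if v: "v \<in> ?V" for v
    proof -
      have "comm (comm X Y) v = comm X (comm Y v) - comm Y (comm X v)"
        by (simp add: comm_def matmul.diff_left matmul.diff_right matrix_mul_assoc)
      then show ?thesis using X Y v by (simp add: span_diff)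
    qed
    then show ?thesis using X Y by simp
  qed
  ultimately show "lie_subalgebra ?L" by (simp add: lie_subalgebra_def)
  show "\<B> \<subseteq> ?L"
    using comm_span_conj_orbit by (auto intro: span_base conj_orbit.base)
  obtain g where "attained W g" using assms by (auto simp: maximal_def)
  then have "?V \<subseteq> W"
    using conj_orbit_maximal[OF _ assms] by (intro span_minimal attained_subspace) auto
  then show "?L \<subseteq> W" by blast
qed

text \<open>The scalar factor \<open>exp (\<tau> Y)\<close> supplies the one direction transversal to \<^const>\<open>SL\<close>. With it the derivative
  at zero becomes \<open>Y \<mapsto> Y ** g\<close>, which is invertible, so the image contains an open set of matrices.
  Matrices \<open>Y\<close> near zero are sent to multiples of matrices in \<open>R\<close>, and such a multiple of determinant one has \<open>\<tau> Y = 0\<close> and therefore belongs to \<open>R\<close>.\<close>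

lemma interior_of_if_attained_sl:
  assumes "attained W g" and "sl \<subseteq> W" and "R \<subseteq> SL"
  shows "top_of_set SL interior_of R \<noteq> {}"
proof -
  obtain \<Phi> \<psi> :: "real^'n^'n \<Rightarrow> real^'n^'n" where \<psi>: "linear \<psi>" "range \<psi> = W" and cont: "continuous_on UNIV \<Phi>"
    and \<Phi>: "\<Phi> 0 = g" "(\<Phi> has_derivative (\<lambda>Y. \<psi> Y ** g)) (at 0)" "\<forall>\<^sub>F Y in nhds 0. \<Phi> Y \<in> R"
    using assms(1) unfolding attained_def by blast
  obtain q where q: "linear q" "\<And>w. w \<in> W \<Longrightarrow> \<psi> (q w) = w"
    using linear_right_inverse_on_range[OF \<psi>(1)] \<psi>(2) by metis
  define \<tau> where "\<tau> Y = trace Y / real CARD('n)" for Y :: "real^'n^'n"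
  define p where "p Y = q (Y - \<tau> Y *\<^sub>R mat 1)" for Y
  \<comment> \<open>\<open>Y\<close> is split into a scalar and a traceless part; \<open>\<psi> (p Y)\<close> is the traceless part.\<close>
  define F where "F Y = exp (\<tau> Y) *\<^sub>R \<Phi> (p Y)" for Y
  have \<tau>: "linear \<tau>"
    unfolding \<tau>_def by (rule linearI) (simp_all add: trace_def sum.distrib sum_distrib_left add_divide_distrib)
  have p: "linear p"
    unfolding p_def
    by (rule linearI) (simp_all add: linear_add[OF \<tau>] linear_cmul[OF \<tau>] linear_add[OF q(1)]
        linear_diff[OF q(1)] linear_cmul[OF q(1)] algebra_simps)
  have bl: "bounded_linear \<tau>" "bounded_linear p"
    using \<tau> p by (simp_all add: linear_conv_bounded_linear)
  have zero: "\<tau> 0 = 0" "p 0 = 0" by (simp_all add: linear_0[OF \<tau>] linear_0[OF p])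
  have \<psi>p: "\<psi> (p Y) = Y - \<tau> Y *\<^sub>R mat 1" for Y
  proof -
    have "trace (Y - \<tau> Y *\<^sub>R mat 1) = 0"
      by (simp add: \<tau>_def trace_def mat_def sum_subtractf)
    then show ?thesis
      unfolding p_def using assms(2) by (intro q(2)) (auto simp: sl_def)
  qed
  have "\<forall>\<^sub>F Y in nhds 0. \<Phi> (p Y) \<in> R"
  proof -
    have "filterlim p (nhds 0) (nhds 0)" by (rule tendsto_0_linear[OF p])
    then show ?thesis by (rule eventually_compose_filterlim[OF \<Phi>(3)])
  qed
  then obtain N where N: "open N" "0 \<in> N" "\<And>Y. Y \<in> N \<Longrightarrow> \<Phi> (p Y) \<in> R"
    unfolding eventually_nhds by auto
  have "g \<in> R" using N(2) N(3)[of 0] by (simp add: zero \<Phi>(1))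
  then have "det g = 1" using assms(3) by (auto simp: SL_def)
  then obtain g' where g': "g' ** g = mat 1"
    using invertible_det_nz[of g] by (auto simp: invertible_def)
  have "(F has_derivative (\<lambda>Y. Y ** g)) (at 0)"
  proof -
    have "(p has_derivative p) (at 0)"
      by (rule bounded_linear_imp_has_derivative[OF bl(2)])
    moreover have "(\<Phi> has_derivative (\<lambda>Y. \<psi> Y ** g)) (at (p 0))"
      using \<Phi>(2) by (simp add: zero)
    ultimately have "((\<lambda>Y. \<Phi> (p Y)) has_derivative (\<lambda>Y. \<psi> (p Y) ** g)) (at 0)"
      by (rule has_derivative_compose)
    moreover have "((\<lambda>Y. exp (\<tau> Y)) has_derivative \<tau>) (at 0)"
      using bounded_linear_imp_has_derivative[OF bl(1)]
      by (auto intro!: derivative_eq_intros simp: zero)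
    ultimately have "(F has_derivative (\<lambda>Y. exp (\<tau> 0) *\<^sub>R (\<psi> (p Y) ** g) + \<tau> Y *\<^sub>R \<Phi> (p 0))) (at 0)"
      unfolding F_def by (intro has_derivative_scaleR)
    moreover have "exp (\<tau> 0) *\<^sub>R (\<psi> (p Y) ** g) + \<tau> Y *\<^sub>R \<Phi> (p 0) = Y ** g" for Y
      by (simp add: zero \<Phi>(1) \<psi>p matmul.diff_left matmul.scaleR_left)
    ultimately show ?thesis by simp
  qed
  moreover have "continuous_on UNIV F"
    unfolding F_def
    by (intro continuous_intros linear_continuous_on bl continuous_on_compose2[OF cont]) auto
  moreover have "bounded_linear (\<lambda>Z :: real^'n^'n. Z ** g')" by (rule matmul.bounded_linear_left)
  moreover have "(\<lambda>Y. Y ** g) \<circ> (\<lambda>Z :: real^'n^'n. Z ** g') = id"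
    by (simp add: fun_eq_iff matrix_mul_assoc[symmetric] g')
  ultimately have "F 0 \<in> interior (F ` N)"
    using N(1,2) by (intro sussmann_open_mapping[of UNIV F 0 "\<lambda>Y. Y ** g" "\<lambda>Z. Z ** g'" N])
       (auto simp: interior_open)
  then have "g \<in> SL \<inter> interior (F ` N)"
    using \<open>det g = 1\<close> by (simp add: F_def zero \<Phi>(1) SL_def)
  moreover have "SL \<inter> interior (F ` N) \<subseteq> R"
  proof
    fix Z assume Z: "Z \<in> SL \<inter> interior (F ` N)"
    then obtain Y where Y: "Y \<in> N" "Z = F Y" using interior_subset by blast
    have "det (\<Phi> (p Y)) = 1" using N(3)[OF Y(1)] assms(3) by (auto simp: SL_def)
    then have "exp (\<tau> Y) ^ CARD('n) = 1"
      using Z Y(2) by (simp add: SL_def F_def det_scaleR)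
    then have "exp (\<tau> Y) = 1" by (simp flip: exp_of_nat_mult)
    then show "Z \<in> R" using N(3)[OF Y(1)] by (simp add: Y(2) F_def)
  qed
  moreover have "openin (top_of_set SL) (SL \<inter> interior (F ` N))"
    by (simp add: openin_open_Int)
  ultimately show ?thesis unfolding interior_of_def by blast
qed

lemma interior_of_if_lie_closure:
  assumes "\<And>L. lie_subalgebra L \<Longrightarrow> \<B> \<subseteq> L \<Longrightarrow> sl \<subseteq> L" and "R \<subseteq> SL"
  shows "top_of_set SL interior_of R \<noteq> {}"
proof -
  obtain W where W: "maximal W" using maximal_exists by blast
  then obtain L where "lie_subalgebra L" "\<B> \<subseteq> L" "L \<subseteq> W"
    by (rule maximal_contains_lie_subalgebra)
  with assms(1) have "sl \<subseteq> W" by blast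
  with W interior_of_if_attained_sl assms(2) show ?thesis by (auto simp: maximal_def)
qed

end

section \<open>Invariant coordinate blocks\<close>

text \<open>Removing one exceptional point splits an interval into two intervals with one exceptional point
  fewer.\<close>

lemma finite_image_piecewise_constant:
  fixes D :: "real set"
  assumes "finite S" and "is_interval D"
    and "\<And>I. is_interval I \<Longrightarrow> I \<subseteq> D - S \<Longrightarrow> f constant_on I"
  shows "finite (f ` (D - S))"
  using assms
proof (induction S arbitrary: D)
  case empty
  then have "f constant_on D" by simp
  then obtain c where "f ` D \<subseteq> {c}" by (auto simp: constant_on_def)
  then show ?case by (simp add: finite_subset)
next
  case (insert s S)
  have part: "finite (f ` (D' - S))" if "is_interval D'" "D' - S \<subseteq> D - insert s S" for D'
  proof (rule insert.IH[OF that(1)])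
    fix I assume "is_interval I" "I \<subseteq> D' - S"
    then show "f constant_on I" using that(2) by (meson insert.prems(2) order_trans)
  qed
  have "is_interval (D \<inter> {..<s})" "is_interval (D \<inter> {s<..})"
    using insert.prems(1) by (simp_all add: is_interval_Int)
  with part[of "D \<inter> {..<s}"] part[of "D \<inter> {s<..}"]
have "finite (f ` (D \<inter> {..<s} - S) \<union> f ` (D \<inter> {s<..} - S))" by auto
  moreover have "D - insert s S \<subseteq> (D \<inter> {..<s} - S) \<union> (D \<inter> {s<..} - S)" by auto
  ultimately show ?case by (metis finite_subset image_Un image_mono)
qed

lemma piecewise_constant_on_bounded:
  assumes "piecewise_constant_on D f" and "is_interval D"
  obtains S K where "finite S" and "\<And>t. t \<in> D - S \<Longrightarrow> \<bar>f t\<bar> \<le> K"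
proof -
  obtain S where S: "finite S" "\<And>I. is_interval I \<Longrightarrow> I \<subseteq> D - S \<Longrightarrow> f constant_on I"
    using assms(1) unfolding piecewise_constant_on_def by blast
  then have "bounded (f ` (D - S))"
    using assms(2) by (intro finite_imp_bounded finite_image_piecewise_constant)
  then obtain K where "\<And>t. t \<in> D - S \<Longrightarrow> \<bar>f t\<bar> \<le> K" by (auto simp: bounded_iff)
  with S(1) that show thesis by blast
qed

text \<open>The function \<open>exp (- K t) * h t\<close> has nonpositive derivative outside a finite set, and the fundamental
  theorem of calculus tolerates such a set.\<close>

lemma gronwall_nonpos:
  fixes h h' :: "real \<Rightarrow> real"
  assumes "finite S" and "0 \<le> T" and cont: "continuous_on {0..T} h" and "h 0 = 0"
    and deriv: "\<And>t. t \<in> {0<..<T} - S \<Longrightarrow> (h has_real_derivative h' t) (at t)"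
    and bound: "\<And>t. t \<in> {0<..<T} - S \<Longrightarrow> h' t \<le> K * h t"
  shows "h T \<le> 0"
proof -
  let ?w = "\<lambda>t. exp (- K * t) * h t"
  \<comment> \<open>The derivative of \<open>?w\<close>, set to zero at the finitely many times where it may not exist.\<close>
  define w' where "w' t = (if t \<in> {0<..<T} - S then exp (- K * t) * (h' t - K * h t) else 0)" for t
  have "(w' has_integral (?w T - ?w 0)) {0..T}"
  proof (rule fundamental_theorem_of_calculus_interior_strong[OF \<open>finite S\<close> \<open>0 \<le> T\<close>])
    show "continuous_on {0..T} ?w" by (intro continuous_intros cont)
    fix t assume t: "t \<in> {0<..<T} - S"
    have "((\<lambda>t. exp (- K * t)) has_real_derivative exp (- K * t) * - K) (at t)"
      by (auto intro!: derivative_eq_intros)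
    from DERIV_mult[OF this deriv[OF t]]
    have "(?w has_real_derivative exp (- K * t) * (h' t - K * h t)) (at t)"
      by (simp add: algebra_simps)
    then show "(?w has_vector_derivative w' t) (at t)"
      using t by (simp only: w'_def if_True has_real_derivative_iff_has_vector_derivative)
  qed
  moreover have "w' t \<le> 0" for t
    using bound[of t] by (simp add: w'_def mult_le_0_iff)
  ultimately have "?w T - ?w 0 \<le> 0"
    using has_integral_le[OF _ has_integral_0] by blast
  then show ?thesis using \<open>h 0 = 0\<close> by (simp add: mult_le_0_iff)
qed

lemma control_matrix_nth:
  "control_matrix m1 m2 i j w $ a $ b =
     (\<Sum>k = 1..m1. w k * E_mat (i k) (j k) $ a $ b) + (\<Sum>k = m1+1..m2. w k * C_mat (i k) (j k) $ a $ b)"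
  by (simp add: control_matrix_def)

lemma control_matrix_bound:
  assumes "m1 \<le> m2" and "\<And>k. k \<in> {1..m2} \<Longrightarrow> \<bar>w k\<bar> \<le> K k"
  shows "\<bar>control_matrix m1 m2 i j w $ a $ b\<bar> \<le> (\<Sum>k = 1..m1. K k) + (\<Sum>k = m1+1..m2. K k)"
proof -
  have *: "\<bar>\<Sum>k\<in>I. w k * c k\<bar> \<le> (\<Sum>k\<in>I. K k)"
    if I: "I \<subseteq> {1..m2}" and c: "\<And>k. \<bar>c k\<bar> \<le> 1" for I and c :: "nat \<Rightarrow> real"
  proof -
    have "\<bar>w k * c k\<bar> \<le> K k" if "k \<in> I" for k
    proof -
      have "\<bar>w k\<bar> * \<bar>c k\<bar> \<le> \<bar>w k\<bar> * 1"
        by (rule mult_left_mono[OF c]) simp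
      also have "\<dots> \<le> K k" using assms(2) I that by auto
      finally show ?thesis by (simp add: abs_mult)
    qed
    then have "(\<Sum>k\<in>I. \<bar>w k * c k\<bar>) \<le> (\<Sum>k\<in>I. K k)" by (rule sum_mono)
    then show ?thesis by (rule order_trans[OF sum_abs])
  qed
  have "\<bar>\<Sum>k = 1..m1. w k * E_mat (i k) (j k) $ a $ b\<bar> \<le> (\<Sum>k = 1..m1. K k)"
    using assms(1) by (intro *) (auto simp: E_mat_nth)
  moreover have "\<bar>\<Sum>k = m1+1..m2. w k * C_mat (i k) (j k) $ a $ b\<bar> \<le> (\<Sum>k = m1+1..m2. K k)"
    by (intro *) (auto simp: E_mat_nth C_mat_def)
  ultimately show ?thesis
    unfolding control_matrix_nth by linarith
qed

text \<open>If no arc leaves \<open>P\<close>, the entries with row in \<open>P\<close> and a fixed column \<open>y\<close> obey a linear equation among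
  themselves. For \<open>y\<close> outside \<open>P\<close> they vanish initially, and the sum \<open>h\<close> of their squares satisfies
  a Gronwall inequality because piecewise constant controls are bounded off a finite set.\<close>

lemma reachable_block_zero:
  assumes "m1 \<le> m2"
    and A: "\<And>a b. a \<in> P \<Longrightarrow> b \<notin> P \<Longrightarrow> A $ a $ b = 0"
    and E: "\<And>k. k \<in> {1..m1} \<Longrightarrow> i k \<in> P \<Longrightarrow> j k \<in> P"
    and Z: "Z \<in> reachable_set A m1 m2 i j" and a: "a \<in> P" and y: "y \<notin> P"
  shows "Z $ a $ y = 0"
proof -
  obtain T X u where "0 \<le> T" and u: "\<forall>k\<in>{1..m2}. piecewise_constant_on {0..T} (u k)"
    and sol: "is_solution A m1 m2 i j u T X" and X: "X 0 = mat 1" "X T = Z"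
    using Z unfolding reachable_set_def reachable_at_def by (auto simp del: atLeastAtMost_iff)
  define M where "M t = A + control_matrix m1 m2 i j (\<lambda>k. u k t)" for t
  obtain S\<^sub>0 where "finite S\<^sub>0" and S\<^sub>0: "\<And>s. s \<in> {0..T} - S\<^sub>0 \<Longrightarrow>
      (X has_vector_derivative (A ** X s + control_matrix m1 m2 i j (\<lambda>k. u k s) ** X s)) (at s within {0..T})"
    and cont: "continuous_on {0..T} X"
    using sol unfolding is_solution_def by auto
  have "\<exists>S K. finite S \<and> (\<forall>t\<in>{0..T} - S. \<bar>u k t\<bar> \<le> K)" if "k \<in> {1..m2}" for k
    using piecewise_constant_on_bounded[of "{0..T}" "u k"] u that by (metis is_interval_cc)
  then obtain S\<^sub>1 K where S\<^sub>1: "\<And>k. k \<in> {1..m2} \<Longrightarrow> finite (S\<^sub>1 k)"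
    "\<And>k t. k \<in> {1..m2} \<Longrightarrow> t \<in> {0..T} - S\<^sub>1 k \<Longrightarrow> \<bar>u k t\<bar> \<le> K k"
    by metis
  define S where "S = S\<^sub>0 \<union> (\<Union>k\<in>{1..m2}. S\<^sub>1 k)"
  have "finite S" using \<open>finite S\<^sub>0\<close> S\<^sub>1(1) by (auto simp: S_def)
  define m where "m = (\<Sum>k = 1..m1. K k) + (\<Sum>k = m1+1..m2. K k) + (\<Sum>a\<in>UNIV. \<Sum>b\<in>UNIV. \<bar>A $ a $ b\<bar>)"
  have M_bound: "\<bar>M t $ a $ b\<bar> \<le> m" if "t \<in> {0..T} - S" for t a b
  proof -
    have "\<bar>A $ a $ b\<bar> \<le> (\<Sum>b\<in>UNIV. \<bar>A $ a $ b\<bar>)"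
      by (rule member_le_sum) auto
    also have "\<dots> \<le> (\<Sum>a\<in>UNIV. \<Sum>b\<in>UNIV. \<bar>A $ a $ b\<bar>)"
      by (rule member_le_sum[where f = "\<lambda>a. \<Sum>b\<in>UNIV. \<bar>A $ a $ b\<bar>"]) (auto intro: sum_nonneg)
    finally show ?thesis
      using control_matrix_bound[OF assms(1), of "\<lambda>k. u k t" K i j a b] S\<^sub>1(2) that
      by (fastforce simp: M_def m_def S_def)
  qed
  have M_zero: "M t $ a $ b = 0" if "a \<in> P" "b \<notin> P" for t a b
  proof -
    have "(\<Sum>k = 1..m1. u k t * E_mat (i k) (j k) $ a $ b) = 0"
      using E that by (intro sum.neutral) (auto simp: E_mat_nth)
    moreover have "C_mat (i k) (j k) $ a $ b = 0" for k
      using that by (auto simp: C_mat_def E_mat_nth)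
    ultimately show ?thesis
      unfolding M_def vector_add_component control_matrix_nth
      using A[OF that] by simp
  qed
  define x where "x t a = X t $ a $ y" for t a
  define h where "h t = (\<Sum>a\<in>P. (x t a)\<^sup>2)" for t
  define h' where "h' t = (\<Sum>a\<in>P. 2 * x t a * (\<Sum>b\<in>P. M t $ a $ b * x t b))" for t
  have "h T \<le> 0"
  proof (rule gronwall_nonpos[OF \<open>finite S\<close> \<open>0 \<le> T\<close>])
    show "continuous_on {0..T} h"
      unfolding h_def x_def by (intro continuous_intros cont)
    show "h 0 = 0"
      unfolding h_def x_def using y by (intro sum.neutral) (auto simp: X(1) mat_def)
    fix t assume t: "t \<in> {0<..<T} - S"
    have "(X has_vector_derivative M t ** X t) (at t)"
      using S\<^sub>0[of t] t by (simp add: M_def S_def matmul.add_left at_within_Icc_at)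
    then have "((\<lambda>t. x t a) has_real_derivative (M t ** X t) $ a $ y) (at t)" for a
      unfolding x_def has_real_derivative_iff_has_vector_derivative
      by (intro bounded_linear.has_vector_derivative[OF bounded_linear_vec_nth])
    moreover have "(M t ** X t) $ a $ y = (\<Sum>b\<in>P. M t $ a $ b * x t b)" if "a \<in> P" for a
      unfolding matrix_mult_nth x_def using M_zero[OF that]
      by (intro sum.mono_neutral_right) auto
    ultimately have "((\<lambda>t. x t a) has_real_derivative (\<Sum>b\<in>P. M t $ a $ b * x t b)) (at t)" if "a \<in> P" for a
      using that by metis
    then show "(h has_real_derivative h' t) (at t)"
      unfolding h_def h'_def by (auto intro!: derivative_eq_intros sum.cong)
    have "2 * x t a * (\<Sum>b\<in>P. M t $ a $ b * x t b) \<le> (\<Sum>b\<in>P. m * ((x t a)\<^sup>2 + (x t b)\<^sup>2))" for a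
      unfolding sum_distrib_left
    proof (rule sum_mono)
      fix b
      have "2 * x t a * (M t $ a $ b * x t b) \<le> \<bar>M t $ a $ b\<bar> * (2 * \<bar>x t a\<bar> * \<bar>x t b\<bar>)"
        using abs_ge_self[of "2 * x t a * (M t $ a $ b * x t b)"] by (simp add: abs_mult mult_ac)
      also have "\<dots> \<le> m * ((x t a)\<^sup>2 + (x t b)\<^sup>2)"
        using M_bound[of t a b] t sum_squares_bound[of "\<bar>x t a\<bar>" "\<bar>x t b\<bar>"]
        by (intro mult_mono) auto
      finally show "2 * x t a * (M t $ a $ b * x t b) \<le> m * ((x t a)\<^sup>2 + (x t b)\<^sup>2)" .
    qed
    then have "h' t \<le> (\<Sum>a\<in>P. \<Sum>b\<in>P. m * ((x t a)\<^sup>2 + (x t b)\<^sup>2))"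
      unfolding h'_def by (intro sum_mono)
    also have "\<dots> = (2 * m * real (card P)) * h t"
      by (simp add: h_def sum.distrib sum_distrib_left[symmetric] algebra_simps)
    finally show "h' t \<le> (2 * m * real (card P)) * h t" .
  qed
  moreover have "(x T a)\<^sup>2 \<le> h T"
    unfolding h_def using a by (intro member_le_sum) auto
  ultimately have "(x T a)\<^sup>2 \<le> 0" by linarith
  then show ?thesis by (simp add: x_def X(2))
qed

lemma det_mat_1_plus_E_mat:
  assumes "c \<noteq> y"
  shows "det (mat 1 + s *\<^sub>R E_mat c y) = 1"
proof -
  let ?I = "mat 1 :: real^'a^'a"
  have "mat 1 + s *\<^sub>R E_mat c y = (\<chi> k. if k = c then row c ?I + s *s row y ?I else row k ?I)"
    by (auto simp: vec_eq_iff row_def mat_def E_mat_nth)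
  then show ?thesis by (simp add: det_row_operation[OF assms])
qed

text \<open>Near a reachable \<open>Z\<close> with \<open>Z $ x $ y = 0\<close> there is a matrix of determinant one with a nonzero
  entry at the same place: row \<open>x\<close> of \<open>Z\<close> has some nonzero entry, in column \<open>c\<close>, and a small
  multiple of column \<open>c\<close> is added to column \<open>y\<close>.\<close>

lemma not_accessible_if_zero_entry:
  assumes zero: "\<And>Z. Z \<in> reachable_set A m1 m2 i j \<Longrightarrow> Z $ x $ y = 0"
  shows "\<not> accessible A m1 m2 i j"
proof
  assume "accessible A m1 m2 i j"
  then obtain Z T where "openin (top_of_set SL) T" and "Z \<in> T" and T: "T \<subseteq> reachable_set A m1 m2 i j"
    by (auto simp: accessible_def interior_of_def)
  then obtain U where U: "open U" "T = SL \<inter> U" by (auto simp: openin_open)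
  have "det Z = 1" "Z \<in> U" "Z $ x $ y = 0"
    using \<open>Z \<in> T\<close> U(2) zero T by (auto simp: SL_def)
  have "row x Z \<noteq> 0" using det_zero_row(1)[of x Z] \<open>det Z = 1\<close> by auto
  then obtain c where c: "Z $ x $ c \<noteq> 0" by (auto simp: row_def vec_eq_iff)
  with \<open>Z $ x $ y = 0\<close> have "c \<noteq> y" by auto
  let ?Y = "\<lambda>s. Z ** (mat 1 + s *\<^sub>R E_mat c y)"
  have "isCont ?Y 0"
    by (intro continuous_intros matmul.isCont)
  then have "\<forall>\<^sub>F s in at 0. ?Y s \<in> U"
    using U(1) \<open>Z \<in> U\<close> by (auto simp: isCont_def intro: topological_tendstoD)
  then have "\<forall>\<^sub>F s in at 0. ?Y s \<in> U \<and> s \<noteq> 0"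
    by (simp add: eventually_at_filter)
  then obtain s where s: "?Y s \<in> U" "s \<noteq> 0"
    using eventually_happens' at_neq_bot by blast
  then have "?Y s \<in> reachable_set A m1 m2 i j"
    using T U(2) \<open>det Z = 1\<close> \<open>c \<noteq> y\<close> by (auto simp: SL_def det_mul det_mat_1_plus_E_mat)
  then have "?Y s $ x $ y = 0" by (rule zero)
  moreover have "?Y s $ x $ y = s * Z $ x $ c"
    using \<open>Z $ x $ y = 0\<close> by (simp add: matmul.add_right matmul.scaleR_right E_mat_mult_right)
  ultimately show False using s(2) c by simp
qed

section \<open>The accessibility criterion\<close>

lemma lie_subalgebra_admissible:
  assumes L: "lie_subalgebra L" and sub: "admissible A m1 m2 i j \<subseteq> L"
  shows "A \<in> L" and "k \<in> {1..m1} \<Longrightarrow> E_mat (i k) (j k) \<in> L"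
proof -
  have A: "A + control_matrix m1 m2 i j w \<in> L" for w
    using sub by (auto simp: admissible_def)
  show "A \<in> L" using A[of "\<lambda>_. 0"] by (simp add: control_matrix_def)
  assume k: "k \<in> {1..m1}"
  \<comment> \<open>Switching on a single control with value one: each control matrix \<open>E_mat\<close> is a difference of two admissible matrices.\<close>
  let ?w = "\<lambda>l. if l = k then 1 else 0 :: real"
  have "control_matrix m1 m2 i j ?w = (\<Sum>l = 1..m1. if l = k then E_mat (i k) (j k) else 0)"
    unfolding control_matrix_def using k
    by (auto simp: if_distrib[of "\<lambda>c. c *\<^sub>R _"] intro!: sum.neutral cong: if_cong)
  then have "control_matrix m1 m2 i j ?w = E_mat (i k) (j k)"
    using k by simp
  then have "A + E_mat (i k) (j k) - A \<in> L"
    using A[of ?w] \<open>A \<in> L\<close> L by (intro subspace_diff) (auto simp: lie_subalgebra_def)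
  then show "E_mat (i k) (j k) \<in> L" by simp
qed

theorem theorem3:
  fixes A :: "real^'n^'n" and m1 m2 :: nat and i j :: "nat \<Rightarrow> 'n"
  assumes "A \<in> sl"
    and "m1 \<le> m2"
    and "\<forall>k \<in> {1..m2}. i k \<noteq> j k"
    and "\<forall>H \<in> weak_components (contr_graph m1 i j). strongly_connected H \<and> card (verts H) \<ge> 2"
    and "\<exists>H \<in> weak_components (contr_graph m1 i j). card (verts H) \<ge> 3"
  shows "accessible A m1 m2 i j \<longleftrightarrow>
         strongly_connected (Digraph_Component.union (drift_graph A) (contr_graph m1 i j))"
proof -
  let ?C = "(\<lambda>k. (i k, j k)) ` {1..m1}"
  let ?U = "{(a, b). a \<noteq> b \<and> A $ a $ b \<noteq> 0} \<union> ?C"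
  have "accessible A m1 m2 i j \<longleftrightarrow> (\<forall>u v. (u, v) \<in> ?U\<^sup>*)"
  proof
    assume acc: "accessible A m1 m2 i j"
    show "\<forall>u v. (u, v) \<in> ?U\<^sup>*"
    proof (rule ccontr)
      assume "\<not> (\<forall>u v. (u, v) \<in> ?U\<^sup>*)"
      then obtain x y where "(x, y) \<notin> ?U\<^sup>*" by blast
      \<comment> \<open>The nodes reachable from \<open>x\<close>: no arc of the union graph leaves this set.\<close>
      let ?P = "{v. (x, v) \<in> ?U\<^sup>*}"
      have step: "b \<in> ?P" if "a \<in> ?P" "(a, b) \<in> ?U" for a b
        using that by (simp only: mem_Collect_eq rtrancl.rtrancl_into_rtrancl)
      have "Z $ x $ y = 0" if Z: "Z \<in> reachable_set A m1 m2 i j" for Z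
      proof (rule reachable_block_zero[OF assms(2) _ _ Z])
        show "A $ a $ b = 0" if "a \<in> ?P" "b \<notin> ?P" for a b
          using step[of a b] that by blast
        show "j k \<in> ?P" if "k \<in> {1..m1}" "i k \<in> ?P" for k
          using step[of "i k" "j k"] that by blast
        show "x \<in> ?P" by simp
        show "y \<notin> ?P" using \<open>(x, y) \<notin> ?U\<^sup>*\<close> by simp
      qed
      with acc not_accessible_if_zero_entry show False by blast
    qed
  next
    assume sc: "\<forall>u v. (u, v) \<in> ?U\<^sup>*"
    interpret exp_closed "admissible A m1 m2 i j" "reachable_set A m1 m2 i j"
      by unfold_locales
         (use mat_1_reachable reachable_set_mexp trace_admissible[OF assms(1-3)] in blast)+
    obtain P where P: "card P = 3" "P \<times> P \<subseteq> ?C\<^sup>*"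
      using control_graph_nodes(2)[OF assms(4,5)] by blast
    have "sl \<subseteq> L" if L: "lie_subalgebra L" "admissible A m1 m2 i j \<subseteq> L" for L
    proof (rule generates_sl[OF L(1) _ _ _ P])
      show "A \<in> L" by (rule lie_subalgebra_admissible(1)[OF L])
      show "E_mat a b \<in> L" if "(a, b) \<in> ?C" for a b
        using that lie_subalgebra_admissible(2)[OF L] by blast
      show "\<exists>s. s \<noteq> r \<and> (r, s) \<in> ?C\<^sup>* \<and> (s, r) \<in> ?C\<^sup>*" for r
        by (rule control_graph_nodes(1)[OF assms(4,5)])
      show "(u, v) \<in> ?U\<^sup>*" for u v using sc by blast
    qed
    then show "accessible A m1 m2 i j"
      unfolding accessible_def
      by (rule interior_of_if_lie_closure[OF _ reachable_set_subset_SL])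
  qed
  then show ?thesis by (simp only: strongly_connected_union_iff)
qed

end
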